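(* Let $2\le k<\omega$. Given $A\in\mathcal{E}_k$ and an equivalence relation $R$ on a front $\mathcal{F}$ on $A$, there is $B\le A$ such that $R$ restricted to $\mathcal{F}|B$ is canonical, i.e., there is an irreducible map $\varphi$ on $\mathcal{F}|B$ such that for all $a,b\in\mathcal{F}|B$, $a\,R\,b$ if and only if $\varphi(a)=\varphi(b)$.
   Context: The space $\mathcal{E}_k$: let $\omega^{\not\downarrow\le k}$ be the non-decreasing sequences of naturals of length $\le k$ (including $()$), $\omega^{\not\downarrow k}$ those of length $k$. Well-order $\omega^{\not\downarrow\le k}$ by $\prec$: $()$ least; for nonempty $(j_0,\dots,j_{p-1}),(l_0,\dots,l_{q-1})$, $\prec$ holds iff $j_{p-1}<l_{q-1}$, or $j_{p-1}=l_{q-1}$ and the first is lexicographically below the second (proper initial segments count as below). $\vec j_m$ is its $m$-th element, $m_{\vec l}$ the index of $\vec l$, $\vec i_n$ the $n$-th element of $\omega^{\not\downarrow k}$. $\mathbb{W}_k(\vec j)=\{m_{\vec j\restriction q}:1\le q\le|\vec j|\}$, $\widehat{\mathbb{W}}_k=\{\mathbb{W}_k(\vec j)\}$. An $\mathcal{E}_k$-tree is $\hat X:\omega^{\not\downarrow\le k}\to\widehat{\mathbb{W}}_k$ with (i) $|\hat X(\vec j_m)|=|\vec j_m|$; (ii) $\max\hat X(\vec j_m)<\max\hat X(\vec j_{m+1})$ for $m\ge1$; (iii) $\hat X(\vec j_m)$ is a proper initial segment of $\hat X(\vec j_n)$ iff $\vec j_m$ is a proper initial segment of $\vec j_n$.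 $\mathcal{E}_k$ consists of the restrictions $X=\hat X\restriction\omega^{\not\downarrow k}$, identified with their ranges; $X(n)$ denotes $X(\vec i_n)$. $Y\le X$ iff $Y\subseteq X$. $r_n(X)=\{X(\vec i_p):p<n\}$ (as a function on $\{\vec i_p:p<n\}$); $\mathcal{AR}_n=\{r_n(X):X\in\mathcal{E}_k\}$, $\mathcal{AR}=\bigcup_n\mathcal{AR}_n$; for $a\in\mathcal{AR}_n$, $|a|=n$ and $a(p)=a(\vec i_p)$. $a\le_{\rm fin}b$ iff $a\subseteq b$; $a\sqsubseteq b$ iff $a=r_m(b)$ for some $m\le|b|$, $a\sqsubset Y$ iff $a=r_m(Y)$ for some $m$. Front: $\mathcal{F}\subseteq\mathcal{AR}$ is a front on $A$ if every $Y\le A$ has some $a\in\mathcal{F}$ with $a\sqsubset Y$, and $a\not\sqsubseteq b$ for all distinct $a,b\in\mathcal{F}$. $\mathcal{F}|B=\{a\in\mathcal{F}:a\le_{\rm fin}B\}$. Projections: for $0\le l\le k$ and finite $w\subseteq\omega$ with $\ge l$ elements, $\pi_l(w)$ is the set of its $l$ smallest elements ($\pi_0(w)=\emptyset$). For $a\in\mathcal{AR}$ and $\vec l=(l_0,\dots,l_{|a|-1})\in(k+1)^{|a|}$, $\pi_{\vec l}(a)=\{\pi_{l_m}(a(m)):m<|a|\}$. A map $\varphi$ on a front $\mathcal{F}'$ is inner if for each $a\in\mathcal{F}'$, $\varphi(a)=\pi_{\vec l}(a)$ for some $\vec l\in(k+1)^{|a|}$; Nash-Williams if for all $a,b\in\mathcal{F}'$,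 whenever $\varphi(b)=\pi_{\vec l}(b)$ and there is $n\le|b|$ with $\varphi(a)=\pi_{(l_0,\dots,l_{n-1})}(r_n(b))$, then $\varphi(a)=\varphi(b)$; irreducible if it is both inner and Nash-Williams. *)

theory Defs
  imports Main "HOL-Library.Sublist" "HOL-Library.FuncSet"
begin

definition seqs_le :: "nat \<Rightarrow> nat list set" where
  "seqs_le k = {js. sorted js \<and> length js \<le> k}"

definition seqs_eq :: "nat \<Rightarrow> nat list set" where
  "seqs_eq k = {js. sorted js \<and> length js = k}"

(* Proper initial segments are below their extensions in lexord. *)
definition prec :: "nat list \<Rightarrow> nat list \<Rightarrow> bool" (infix "\<prec>" 50) where
  "js \<prec> ls \<longleftrightarrow>
     js = [] \<and> ls \<noteq> [] \<or>
     js \<noteq> [] \<and> ls \<noteq> [] \<and>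
       (last js < last ls \<or> last js = last ls \<and> (js, ls) \<in> lexord {(a, b). a < b})"

(* Every element of seqs_le k has only finitely many predecessors, because the entries of a
   predecessor are bounded by its last entry; so the rank is a natural number. For k \<ge> 1, both
   seqs_le k and seqs_eq k have order type omega and each rank is attained exactly once. *)
definition rank_in :: "nat list set \<Rightarrow> nat list \<Rightarrow> nat" where
  "rank_in S ls = card {js \<in> S. js \<prec> ls}"

definition nth_in :: "nat list set \<Rightarrow> nat \<Rightarrow> nat list" where
  "nth_in S n = (THE js. js \<in> S \<and> rank_in S js = n)"

definition jvec :: "nat \<Rightarrow> nat \<Rightarrow> nat list" where
  "jvec k m = nth_in (seqs_le k) m"

definition jidx :: "nat \<Rightarrow> nat list \<Rightarrow> nat" where
  "jidx k ls = rank_in (seqs_le k) ls"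

definition ivec :: "nat \<Rightarrow> nat \<Rightarrow> nat list" where
  "ivec k n = nth_in (seqs_eq k) n"

definition W :: "nat \<Rightarrow> nat list \<Rightarrow> nat set" where
  "W k js = {jidx k (take q js) | q. 1 \<le> q \<and> q \<le> length js}"

definition W_hat :: "nat \<Rightarrow> nat set set" where
  "W_hat k = W k ` seqs_le k"

definition proper_init_seg :: "nat set \<Rightarrow> nat set \<Rightarrow> bool" where
  "proper_init_seg u v \<longleftrightarrow> u \<subset> v \<and> (\<forall>x\<in>u. \<forall>y\<in>v - u. x < y)"

definition E_tree :: "nat \<Rightarrow> (nat list \<Rightarrow> nat set) \<Rightarrow> bool" where
  "E_tree k X \<longleftrightarrow>
     X \<in> seqs_le k \<rightarrow> W_hat k \<and>
     (\<forall>m. card (X (jvec k m)) = length (jvec k m)) \<and>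
     (\<forall>m\<ge>1. Max (X (jvec k m)) < Max (X (jvec k (Suc m)))) \<and>
     (\<forall>m n. proper_init_seg (X (jvec k m)) (X (jvec k n)) \<longleftrightarrow>
             strict_prefix (jvec k m) (jvec k n))"

definition E_space :: "nat \<Rightarrow> (nat list \<Rightarrow> nat set) set" where
  "E_space k = {restrict X (seqs_eq k) | X. E_tree k X}"

(* By condition (ii) on trees, a member of the space is determined by its range. *)
definition ran_E :: "nat \<Rightarrow> (nat list \<Rightarrow> nat set) \<Rightarrow> nat set set" where
  "ran_E k X = X ` seqs_eq k"

definition le_E :: "nat \<Rightarrow> (nat list \<Rightarrow> nat set) \<Rightarrow> (nat list \<Rightarrow> nat set) \<Rightarrow> bool" where
  "le_E k Y X \<longleftrightarrow> ran_E k Y \<subseteq> ran_E k X"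

(* A function a on {ivec k p | p. p < n} is encoded as the list of its values a (ivec k p), p < n.
   So |a| is length a, a(p) is a ! p, the range of a is set a, and r_m(a) is take m a. *)
type_synonym approx = "nat set list"

definition approximation :: "nat \<Rightarrow> nat \<Rightarrow> (nat list \<Rightarrow> nat set) \<Rightarrow> approx" where
  "approximation k n X = map (\<lambda>p. X (ivec k p)) [0..<n]"

definition AR_n :: "nat \<Rightarrow> nat \<Rightarrow> approx set" where
  "AR_n k n = approximation k n ` E_space k"

definition AR :: "nat \<Rightarrow> approx set" where
  "AR k = (\<Union>n. AR_n k n)"

definition init_approx :: "approx \<Rightarrow> approx \<Rightarrow> bool" where
  "init_approx a b \<longleftrightarrow> (\<exists>m\<le>length b. a = take m b)"

definition init_of :: "nat \<Rightarrow> approx \<Rightarrow> (nat list \<Rightarrow> nat set) \<Rightarrow> bool" where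
  "init_of k a Y \<longleftrightarrow> (\<exists>m. a = approximation k m Y)"

definition front :: "nat \<Rightarrow> (nat list \<Rightarrow> nat set) \<Rightarrow> approx set \<Rightarrow> bool" where
  "front k A F \<longleftrightarrow>
     F \<subseteq> AR k \<and>
     (\<forall>Y\<in>E_space k. le_E k Y A \<longrightarrow> (\<exists>a\<in>F. init_of k a Y)) \<and>
     (\<forall>a\<in>F. \<forall>b\<in>F. a \<noteq> b \<longrightarrow> \<not> init_approx a b)"

definition front_restrict :: "nat \<Rightarrow> approx set \<Rightarrow> (nat list \<Rightarrow> nat set) \<Rightarrow> approx set" where
  "front_restrict k F B = {a \<in> F. set a \<subseteq> ran_E k B}"

definition proj :: "nat \<Rightarrow> nat set \<Rightarrow> nat set" where
  "proj l w = set (take l (sorted_list_of_set w))"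

definition proj_vec :: "nat list \<Rightarrow> approx \<Rightarrow> nat set set" where
  "proj_vec ls a = {proj (ls ! m) (a ! m) | m. m < length a}"

definition proj_vectors :: "nat \<Rightarrow> nat \<Rightarrow> nat list set" where
  "proj_vectors k n = {ls. length ls = n \<and> set ls \<subseteq> {..k}}"

definition inner_map :: "nat \<Rightarrow> approx set \<Rightarrow> (approx \<Rightarrow> nat set set) \<Rightarrow> bool" where
  "inner_map k F \<phi> \<longleftrightarrow> (\<forall>a\<in>F. \<exists>ls\<in>proj_vectors k (length a). \<phi> a = proj_vec ls a)"

definition nash_williams_map :: "nat \<Rightarrow> approx set \<Rightarrow> (approx \<Rightarrow> nat set set) \<Rightarrow> bool" where
  "nash_williams_map k F \<phi> \<longleftrightarrow>
     (\<forall>a\<in>F. \<forall>b\<in>F. \<forall>ls\<in>proj_vectors k (length b).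
        \<phi> b = proj_vec ls b \<and>
        (\<exists>n\<le>length b. \<phi> a = proj_vec (take n ls) (take n b)) \<longrightarrow> \<phi> a = \<phi> b)"

definition irreducible_map :: "nat \<Rightarrow> approx set \<Rightarrow> (approx \<Rightarrow> nat set set) \<Rightarrow> bool" where
  "irreducible_map k F \<phi> \<longleftrightarrow> inner_map k F \<phi> \<and> nash_williams_map k F \<phi>"

definition canonical_on :: "nat \<Rightarrow> approx set \<Rightarrow> (approx \<times> approx) set \<Rightarrow> bool" where
  "canonical_on k F R \<longleftrightarrow>
     (\<exists>\<phi>. irreducible_map k F \<phi> \<and> (\<forall>a\<in>F. \<forall>b\<in>F. (a, b) \<in> R \<longleftrightarrow> \<phi> a = \<phi> b))"

end

theory Submission
  imports Defs
begin

text \<open>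
  Number the non-decreasing sequences by their rank, so that they form a tree on the naturals
  with parent function p.  Members of the space are then the strictly increasing maps g with
  g (p n) = p (g n), and approximations become finite lists of nodes.

  Fix nonprincipal ultrafilters on the sets of children.  Every node list s below the front carries
  the iterated ultrafilter it induces on the R-classes; two lists mix if these ultrafilters coincide,
  which is an equivalence relation for free.  A node is recorded if prolonging by almost any
  node changes the class ultrafilter.  By a fusion one may assume that two lists which can be separated on
  some subtree are already separated.  On a sufficiently generic subtree, mixing is then the
  same as having the same recorded nodes, and the recorded nodes D(a) are closed under parents.
  So a R b iff D(a) = D(b), and after a further homogenization D(a) is never properly contained in D(b),
  which makes the Nash-Williams property automatic.

  Finally D(a) has to be presented as a set with one projection of each entry of a, depending on D(a)
  only: take the paths to the leaves of D(a), together with the empty set if some entry is not needed to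
  cover the leaves.  Whether this happens can be made constant on the front.
\<close>

section \<open>Embeddings of the node tree\<close>

text \<open>Equality of class ultrafilters is transitive for free, but it is blind to thinned trees:
  the children kept by a fusion need not form a set of the ultrafilter, so separation on a subtree
  says nothing yet about the ultrafilters. Deciding closes this gap: separation obtained on a
  subtree that fixes the nodes up to \<open>i\<close> already holds on the whole front, where the
  ultrafilters see it. This is how configurations excluded by generic nodes refute mixing
  (\<open>not_mixI\<close>). The form of the map is the other obstacle. The Nash-Williams condition
  ranges over all projection vectors representing a value, so it is derived from a property of the
  values as sets: none properly contains another. Inclusions everywhere would give an infinite
  descent of finite sets, once each smaller set is realized inside the subtree at hand. A projection
  of an entry is an initial segment of its path; closure under parents therefore makes the recorded
  nodes a union of projections. An inner map must also project the entries it does not need, and the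
  resulting empty set must not distinguish elements of one class.\<close>

definition ultra :: "'a filter \<Rightarrow> bool" where
  "ultra u \<longleftrightarrow> (\<forall>P. eventually (\<lambda>x. \<not> P x) u \<longleftrightarrow> \<not> eventually P u)"

text \<open>Zorn's lemma gives a minimal nontrivial filter below \<open>F\<close>; the infimum of a
  chain is nontrivial because what holds eventually there does so in a member. If a minimal
  \<open>u\<close> does not have \<open>P\<close> eventually, intersecting it with the complement of
  \<open>P\<close> stays nontrivial, hence changes nothing.\<close>

lemma ultra_exists:
  fixes F :: "'a filter"
  assumes "F \<noteq> bot"
  shows "\<exists>u. ultra u \<and> u \<le> F"
proof -
  let ?A = "{G. G \<noteq> bot \<and> G \<le> F}"
  have po: "partial_order_on ?A (relation_of (\<ge>) ?A)"
    by (rule partial_order_on_relation_ofI) auto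
  have "\<exists>m\<in>?A. \<forall>a\<in>?A. a \<le> m \<longrightarrow> a = m"
  proof (rule predicate_Zorn[OF po])
    fix C assume C: "C \<in> Chains (relation_of (\<ge>) ?A)"
    have sub: "C \<subseteq> ?A"
      using C by (auto simp: Chains_def relation_of_def)
    have lin: "G \<le> H \<or> H \<le> G" if "G \<in> C" "H \<in> C" for G H
      using C that by (auto simp: Chains_def relation_of_def)
    show "\<exists>u\<in>?A. \<forall>a\<in>C. u \<le> a"
    proof (cases "C = {}")
      case True
      then show ?thesis using assms by auto
    next
      case False
      have "\<not> eventually (\<lambda>_. False) (Inf C)"
      proof (subst eventually_Inf_base[OF False])
        show "\<exists>x\<in>C. x \<le> inf G H" if "G \<in> C" "H \<in> C" for G H
          using lin[OF that] that by auto
        show "\<not> (\<exists>b\<in>C. eventually (\<lambda>_. False) b)"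
          using sub by (auto simp: trivial_limit_def[symmetric])
      qed
      then have "Inf C \<noteq> bot" by (simp add: trivial_limit_def)
      moreover have "Inf C \<le> F"
      proof -
        obtain c where "c \<in> C" using False by blast
        then have "Inf C \<le> c" "c \<le> F" using sub by (auto intro: Inf_lower)
        then show ?thesis by (rule order_trans)
      qed
      ultimately show ?thesis by (auto intro: Inf_lower)
    qed
  qed
  then obtain u where u: "u \<noteq> bot" "u \<le> F" and
    min: "\<And>v. v \<noteq> bot \<Longrightarrow> v \<le> F \<Longrightarrow> v \<le> u \<Longrightarrow> v = u" by blast
  have "ultra u"
    unfolding ultra_def
  proof (intro allI iffI)
    fix P assume "eventually (\<lambda>x. \<not> P x) u"
    then show "\<not> eventually P u"
      using u(1) eventually_conj[of "\<lambda>x. \<not> P x" u P] by (auto simp: trivial_limit_def)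
  next
    fix P assume nP: "\<not> eventually P u"
    let ?v = "inf u (principal {x. \<not> P x})"
    have "?v \<noteq> bot"
      using nP by (simp add: trivial_limit_def eventually_inf_principal)
    then have "?v = u" using min u(2) by (meson inf.coboundedI1 inf.cobounded1)
    moreover have "eventually (\<lambda>x. \<not> P x) ?v" by (simp add: eventually_inf_principal)
    ultimately show "eventually (\<lambda>x. \<not> P x) u" by simp
  qed
  with u show ?thesis by blast
qed

text \<open>Parents are smaller than their children, so every set \<open>{..n}\<close> is closed
  under parents. This is what lets finite lists serve as initial segments of embeddings.\<close>

locale node_tree =
  fixes par lvl :: "nat \<Rightarrow> nat" and k :: nat
  assumes par_0: "par 0 = 0"
    and par_less: "0 < n \<Longrightarrow> par n < n"
    and lvl_0: "lvl 0 = 0"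
    and lvl_par: "0 < n \<Longrightarrow> lvl n = Suc (lvl (par n))"
    and lvl_le: "lvl n \<le> k"
    and infinite_children: "lvl q < k \<Longrightarrow> infinite {n. 0 < n \<and> par n = q}"
begin

lemma par_le: "par n \<le> n"
  using par_less[of n] par_0 by (cases "n = 0") auto

text \<open>The possible initial segments of embeddings: entry \<open>i\<close> is the image of node
  \<open>i\<close>, and the root comes first.\<close>

definition valid :: "nat list \<Rightarrow> bool" where
  "valid s \<longleftrightarrow> s \<noteq> [] \<and> sorted_wrt (<) s \<and> s ! 0 = 0 \<and> (\<forall>i<length s. par (s ! i) = s ! par i)"

text \<open>The next entry will be the image of node \<open>length s\<close>, so its parent is
  forced: it is the image of that node's parent, already in the list.\<close>

definition qn :: "nat list \<Rightarrow> nat" where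
  "qn s = s ! par (length s)"

definition emb :: "(nat \<Rightarrow> nat) \<Rightarrow> bool" where
  "emb g \<longleftrightarrow> strict_mono g \<and> g 0 = 0 \<and> (\<forall>n. par (g n) = g (par n))"

lemma valid_ne: "valid s \<Longrightarrow> s \<noteq> []"
  by (simp add: valid_def)

lemma valid_0[simp]: "valid [0]"
  by (simp add: valid_def par_0)

lemma valid_less: "valid s \<Longrightarrow> i < j \<Longrightarrow> j < length s \<Longrightarrow> s ! i < s ! j"
  by (simp add: valid_def sorted_wrt_iff_nth_less)

lemma valid_le_last:
  assumes v: "valid s" and "x \<in> set s"
  shows "x \<le> last s"
proof -
  obtain i where i: "i < length s" "s ! i = x" using assms unfolding in_set_conv_nth by blast
  then consider "i = length s - 1" | "i < length s - 1" by linarith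
  then show ?thesis
    using valid_ne[OF v] valid_less[OF v, of i "length s - 1"] i
    by cases (auto simp: last_conv_nth)
qed

lemma valid_snoc:
  assumes "valid s"
  shows "valid (s @ [n]) \<longleftrightarrow> last s < n \<and> par n = qn s"
proof -
  have ne: "s \<noteq> []" and par: "\<forall>i<length s. par (s ! i) = s ! par i"
    using assms by (auto simp: valid_def)
  have "sorted_wrt (<) (s @ [n]) \<longleftrightarrow> last s < n"
  proof
    assume "sorted_wrt (<) (s @ [n])"
    then show "last s < n" using ne by (auto simp: sorted_wrt_append)
  next
    assume l: "last s < n"
    have "x < n" if "x \<in> set s" for x
      using valid_le_last[OF assms that] l by simp
    then show "sorted_wrt (<) (s @ [n])" using assms
      by (simp add: sorted_wrt_append valid_def)
  qed
  moreover have "(\<forall>i<length (s @ [n]). par ((s @ [n]) ! i) = (s @ [n]) ! par i) \<longleftrightarrow> par n = qn s"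
  proof -
    have 1: "(s @ [n]) ! par (length s) = qn s"
      using par_less[of "length s"] ne by (simp add: nth_append qn_def)
    have 2: "par ((s @ [n]) ! i) = (s @ [n]) ! par i" if "i < length s" for i
      using par par_le[of i] that by (simp add: nth_append)
    have 3: "(s @ [n]) ! length s = n" by simp
    show ?thesis
      unfolding length_append_singleton All_less_Suc 1 3 using 2 by blast
  qed
  ultimately show ?thesis
    using ne assms by (auto simp: valid_def nth_append)
qed

lemma valid_take: "valid s \<Longrightarrow> 0 < n \<Longrightarrow> valid (take n s)"
  using le_less_trans[OF par_le] by (simp add: valid_def sorted_wrt_take)

lemma valid_prefix: "valid s \<Longrightarrow> prefix t s \<Longrightarrow> t \<noteq> [] \<Longrightarrow> valid t"
  using valid_take[of s "length t"] by (auto simp: prefix_def)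


lemma valid_lvl: "valid s \<Longrightarrow> i < length s \<Longrightarrow> lvl (s ! i) = lvl i"
proof (induction i rule: less_induct)
  case (less i)
  show ?case
  proof (cases "i = 0")
    case True
    then show ?thesis using less.prems by (simp add: valid_def)
  next
    case False
    then have "0 < s ! i" using valid_less[OF less.prems(1), of 0 i] less.prems by simp
    moreover have "par (s ! i) = s ! par i" using less.prems by (simp add: valid_def)
    moreover have "par i < i" using False by (simp add: par_less)
    ultimately show ?thesis
      using less.IH[of "par i"] less.prems False by (simp add: lvl_par)
  qed
qed

text \<open>The bound is strict because node \<open>length s\<close> has level one more than its
  parent. Hence the forced parent has infinitely many children and every valid list can be
  prolonged.\<close>

lemma lvl_qn: assumes "valid s" shows "lvl (qn s) < k"
proof -
  have l: "0 < length s" using valid_ne[OF assms] by simp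
  then have "lvl (qn s) = lvl (par (length s))"
    unfolding qn_def using assms by (simp add: par_less valid_lvl)
  with lvl_par[OF l] lvl_le[of "length s"] show ?thesis by simp
qed

lemma valid_par_closed: "valid s \<Longrightarrow> x \<in> set s \<Longrightarrow> par x \<in> set s"
  using le_less_trans[OF par_le] unfolding valid_def in_set_conv_nth by metis

lemma emb_id: "emb (\<lambda>x. x)"
  by (simp add: emb_def strict_mono_def)

lemma emb_comp: "emb g \<Longrightarrow> emb h \<Longrightarrow> emb (\<lambda>x. g (h x))"
  by (simp add: emb_def strict_mono_def)

lemma emb_less_iff: "emb g \<Longrightarrow> g m < g n \<longleftrightarrow> m < n"
  by (simp add: emb_def strict_mono_less)

lemma emb_eq_iff: "emb g \<Longrightarrow> g m = g n \<longleftrightarrow> m = n"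
  by (simp add: emb_def strict_mono_eq)

lemma emb_ge: "emb g \<Longrightarrow> n \<le> g n"
  by (simp add: emb_def strict_mono_imp_increasing)

lemma emb_inj: "emb g \<Longrightarrow> inj g"
  by (simp add: emb_def strict_mono_imp_inj_on)

lemma emb_lvl: assumes "emb g" shows "lvl (g n) = lvl n"
proof (induction n rule: less_induct)
  case (less n)
  show ?case
  proof (cases "n = 0")
    case False
    then have "0 < g n" using emb_ge[OF assms, of n] by simp
    then have "lvl (g n) = Suc (lvl (g (par n)))" using assms by (simp add: lvl_par emb_def)
    then show ?thesis using less.IH[of "par n"] False by (simp add: par_less lvl_par)
  qed (use assms in \<open>simp add: emb_def\<close>)
qed

lemma valid_map_upt: "emb g \<Longrightarrow> valid (map g [0..<Suc n])"
proof -
  assume g: "emb g"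
  have "map g [0..<Suc n] ! par i = g (par i)" if "i < Suc n" for i
    using le_less_trans[OF par_le[of i] that] by (simp del: upt_Suc)
  then show ?thesis using g
    by (simp add: valid_def emb_def sorted_wrt_iff_nth_less strict_mono_def del: upt_Suc)
qed

lemma valid_map: "emb g \<Longrightarrow> valid (map g s) \<longleftrightarrow> valid s"
proof -
  assume g: "emb g"
  have 1: "par (g (s ! i)) = g (par (s ! i))" for i using g by (simp add: emb_def)
  have 2: "map g s ! par i = g (s ! par i)" if "i < length s" for i
    using le_less_trans[OF par_le[of i] that] by simp
  have 3: "g x = 0 \<longleftrightarrow> x = 0" for x using emb_eq_iff[OF g, of x 0] g by (simp add: emb_def)
  show ?thesis
    by (simp add: valid_def sorted_wrt_map emb_less_iff[OF g] 1 2 3 emb_eq_iff[OF g] cong: conj_cong)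
qed

lemma valid_range_map:
  assumes "emb g" "valid s" "set s \<subseteq> range g"
  obtains t where "valid t" "s = map g t"
proof -
  have "map g (map (inv g) s) = s"
    using assms(3) by (auto simp: f_inv_into_f intro!: map_idI)
  with assms that show ?thesis by (metis valid_map)
qed

text \<open>Bar induction and fusion are both instances of this form of dependent choice. The lists
  chosen form a chain of prefixes, and the embedding is their union.\<close>

lemma emb_branch:
  assumes "Inv s0" and valid: "\<And>s. Inv s \<Longrightarrow> valid s"
    and step: "\<And>s. Inv s \<Longrightarrow> \<exists>n. Inv (s @ [n]) \<and> P s n"
  shows "\<exists>g. emb g \<and> map g [0..<length s0] = s0 \<and>
    (\<forall>m\<ge>length s0. Inv (map g [0..<m]) \<and> P (map g [0..<m]) (g m))"
proof -
  have "\<exists>f. \<forall>i. (Inv (f i) \<and> (i = 0 \<longrightarrow> f i = s0)) \<and> (\<exists>n. f (Suc i) = f i @ [n] \<and> P (f i) n)"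
  proof (rule dependent_nat_choice)
    show "\<exists>x. Inv x \<and> ((0::nat) = 0 \<longrightarrow> x = s0)" using assms(1) by auto
    show "\<exists>y. (Inv y \<and> (Suc n = 0 \<longrightarrow> y = s0)) \<and> (\<exists>n. y = x @ [n] \<and> P x n)"
      if "Inv x \<and> (n = 0 \<longrightarrow> x = s0)" for x n
      using step[of x] that by auto
  qed
  then obtain f where ff: "\<And>i. (Inv (f i) \<and> (i = 0 \<longrightarrow> f i = s0)) \<and>
      (\<exists>n. f (Suc i) = f i @ [n] \<and> P (f i) n)" by blast
  have f: "Inv (f i)" "f 0 = s0" and fS: "\<exists>n. f (Suc i) = f i @ [n] \<and> P (f i) n" for i
    using ff[of i] ff[of 0] by simp_all
  have len: "length (f i) = length s0 + i" for i
    using fS by (induction i) (auto simp: f, metis length_append_singleton)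
  have ne: "s0 \<noteq> []" using valid_ne valid f by metis
  have pre: "prefix (f i) (f j)" if "i \<le> j" for i j
    using that
  proof (induction rule: dec_induct)
    case (step j)
    then show ?case using fS[of j] by auto
  qed simp
  \<comment> \<open>\<open>f m\<close> has length \<open>length s0 + m\<close>, which exceeds
    \<open>m\<close> since \<open>s0\<close> is nonempty; entry \<open>m\<close> exists there and
    never changes later.\<close>
  define g where "g m = f m ! m" for m
  have gf: "g m = f i ! m" if "m < length (f i)" for m i
  proof -
    have "m < length (f m)" using ne by (simp add: len)
    with that show ?thesis unfolding g_def
      using pre[of m i] pre[of i m] by (cases "m \<le> i") (auto simp: prefix_def nth_append)
  qed
  have map: "map g [0..<length s0 + i] = f i" for i
    by (rule nth_equalityI) (auto simp: len gf)
  have vf: "valid (f i)" for i using valid f by blast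
  have "emb g"
    unfolding emb_def
  proof (intro conjI allI)
    have "g n < g (Suc n)" for n
      using gf[of n "Suc n"] gf[of "Suc n" "Suc n"] valid_less[OF vf, of n "Suc n" "Suc n"] ne
      by (simp add: len)
    then show "strict_mono g" by (simp add: strict_mono_Suc_iff)
    show "g 0 = 0" using vf[of 0] ne by (simp add: g_def valid_def)
    show "par (g n) = g (par n)" for n
    proof -
      have "par n < length s0 + n" using ne le_less_trans[OF par_le[of n], of "length s0 + n"] by simp
      then show ?thesis
        using gf[of n n] gf[of "par n" n] vf[of n] ne by (simp add: len valid_def)
    qed
  qed
  moreover have "Inv (map g [0..<m]) \<and> P (map g [0..<m]) (g m)" if le: "length s0 \<le> m" for m
  proof -
    obtain i where m: "m = length s0 + i" using le le_Suc_ex by blast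
    obtain n where n: "f (Suc i) = f i @ [n]" "P (f i) n" using fS by blast
    have "g m = n" using gf[of m "Suc i"] n len by (simp add: m nth_append)
    then show ?thesis using n f map[of i] by (simp add: m)
  qed
  moreover have "map g [0..<length s0] = s0" using map[of 0] f by simp
  ultimately show ?thesis by blast
qed

section \<open>Fronts of node lists and bar induction\<close>

definition node_front :: "nat list set \<Rightarrow> bool" where
  "node_front F \<longleftrightarrow> (\<forall>a\<in>F. valid a) \<and> (\<forall>g. emb g \<longrightarrow> (\<exists>n. map g [0..<Suc n] \<in> F)) \<and>
     (\<forall>a\<in>F. \<forall>b\<in>F. prefix a b \<longrightarrow> a = b)"

text \<open>The front below the subtree \<open>range g\<close>, in the coordinates of that subtree,
  so that it is again a front on the whole tree.\<close>

definition pull :: "(nat \<Rightarrow> nat) \<Rightarrow> nat list set \<Rightarrow> nat list set" where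
  "pull g F = {a. valid a \<and> map g a \<in> F}"

lemma node_front_pull:
  assumes "node_front F" "emb g"
  shows "node_front (pull g F)"
  unfolding node_front_def
proof (intro conjI ballI allI impI)
  show "valid a" if "a \<in> pull g F" for a using that by (simp add: pull_def)
next
  fix h assume h: "emb h"
  then have "emb (\<lambda>x. g (h x))" by (rule emb_comp[OF assms(2)])
  with assms(1) obtain n where "map (\<lambda>x. g (h x)) [0..<Suc n] \<in> F"
    unfolding node_front_def by (elim conjE allE impE exE) 
  then have "map h [0..<Suc n] \<in> pull g F"
    using valid_map_upt[OF h] by (simp add: pull_def comp_def del: upt_Suc)
  then show "\<exists>n. map h [0..<Suc n] \<in> pull g F" by blast
next
  fix a b assume ab: "a \<in> pull g F" "b \<in> pull g F" "prefix a b"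
  then have "map g a = map g b"
    using assms(1) map_mono_prefix[of a b g] by (auto simp: node_front_def pull_def)
  then show "a = b" using emb_inj[OF assms(2)] by (simp add: inj_map_eq_map)
qed

lemma pull_comp: "emb h \<Longrightarrow> pull h (pull g F) = pull (\<lambda>x. g (h x)) F"
  by (auto simp: pull_def comp_def valid_map)

definition tr :: "nat list set \<Rightarrow> nat list \<Rightarrow> bool" where
  "tr F s \<longleftrightarrow> valid s \<and> (\<forall>t. strict_prefix t s \<longrightarrow> t \<notin> F)"

lemma tr_valid: "tr F s \<Longrightarrow> valid s"
  by (simp add: tr_def)

lemma tr_snoc: "s \<noteq> [] \<Longrightarrow> tr F (s @ [n]) \<longleftrightarrow> tr F s \<and> s \<notin> F \<and> last s < n \<and> par n = qn s"
proof -
  assume ne: "s \<noteq> []"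
  have "strict_prefix t (s @ [n]) \<longleftrightarrow> t = s \<or> strict_prefix t s" for t
    by (auto simp: strict_prefix_def)
  moreover have "valid (s @ [n]) \<longleftrightarrow> valid s \<and> last s < n \<and> par n = qn s"
    using valid_snoc[of s n] valid_prefix[of "s @ [n]" s] ne by auto
  ultimately show ?thesis by (auto simp: tr_def)
qed

lemma tr_prefix: "tr F s \<Longrightarrow> prefix t s \<Longrightarrow> t \<noteq> [] \<Longrightarrow> tr F t"
  unfolding tr_def using valid_prefix by (meson prefix_order.strict_trans2)

lemma front_tr: "node_front F \<Longrightarrow> a \<in> F \<Longrightarrow> tr F a"
  by (auto simp: tr_def node_front_def strict_prefix_def)

lemma front_valid: "node_front F \<Longrightarrow> a \<in> F \<Longrightarrow> valid a"
  by (simp add: node_front_def)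

lemma tr_0: "node_front F \<Longrightarrow> tr F [0]"
proof -
  assume F: "node_front F"
  have "t \<notin> F" if "strict_prefix t [0]" for t
  proof -
    have "t = []" using that by (cases t) (auto simp: strict_prefix_def)
    then show ?thesis using F by (auto simp: node_front_def valid_def)
  qed
  then show ?thesis by (simp add: tr_def)
qed

text \<open>A failure of \<open>Q\<close> would pass on to one-node prolongations outside the front
  forever, and the resulting embedding would have no initial segment in the front.\<close>

lemma bar_induct[consumes 2, case_names leaf node]:
  assumes front: "node_front F" and "tr F s"
    and leaf: "\<And>s. s \<in> F \<Longrightarrow> Q s"
    and node: "\<And>s. tr F s \<Longrightarrow> s \<notin> F \<Longrightarrow> (\<And>n. tr F (s @ [n]) \<Longrightarrow> Q (s @ [n])) \<Longrightarrow> Q s"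
  shows "Q s"
proof (rule ccontr)
  assume nQ: "\<not> Q s"
  define Inv where "Inv t \<longleftrightarrow> tr F t \<and> t \<notin> F \<and> \<not> Q t" for t
  have "\<exists>g. emb g \<and> map g [0..<length s] = s \<and>
    (\<forall>m\<ge>length s. Inv (map g [0..<m]) \<and> True)"
  proof (rule emb_branch)
    show "Inv s" using assms nQ by (auto simp: Inv_def)
    show "valid t" if "Inv t" for t using that by (simp add: Inv_def tr_def)
    show "\<exists>n. Inv (t @ [n]) \<and> True" if I: "Inv t" for t
    proof -
      obtain n where "tr F (t @ [n])" "\<not> Q (t @ [n])"
        using I node[of t] unfolding Inv_def by blast
      then show ?thesis using leaf[of "t @ [n]"] unfolding Inv_def by blast
    qed
  qed
  then obtain g where g: "emb g" "\<And>m. length s \<le> m \<Longrightarrow> Inv (map g [0..<m])" by blast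
  obtain n where n: "map g [0..<Suc n] \<in> F" using front g(1) by (auto simp: node_front_def)
  define m where "m = max (length s) (Suc n)"
  have "Inv (map g [0..<m])" using g(2) by (simp add: m_def)
  moreover have "prefix (map g [0..<Suc n]) (map g [0..<m])"
  proof -
    have "[0..<m] = [0..<Suc n] @ [Suc n..<m]"
      using upt_add_eq_append[of 0 "Suc n" "m - Suc n"] by (simp add: m_def del: upt_Suc)
    then show ?thesis by (simp del: upt_Suc)
  qed
  ultimately show False using n
    by (auto simp: Inv_def tr_def strict_prefix_def)
qed

end

section \<open>Iterated ultrafilters and fusion\<close>

context node_tree
begin

definition U :: "nat \<Rightarrow> nat filter" where
  "U q = (SOME u. ultra u \<and> u \<le> inf at_top (principal {n. 0 < n \<and> par n = q}))"

lemma U_spec: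
  assumes "lvl q < k"
  shows "ultra (U q) \<and> U q \<le> inf at_top (principal {n. 0 < n \<and> par n = q})"
  unfolding U_def
proof (rule someI_ex, rule ultra_exists)
  show "inf at_top (principal {n. 0 < n \<and> par n = q}) \<noteq> bot"
    using infinite_children[OF assms]
    unfolding trivial_limit_def eventually_inf_principal eventually_at_top_linorder
      finite_nat_set_iff_bounded by (auto simp: not_le not_less)
qed

lemma U_not: "lvl q < k \<Longrightarrow> eventually (\<lambda>n. \<not> P n) (U q) \<longleftrightarrow> \<not> eventually P (U q)"
  using U_spec[of q] by (simp add: ultra_def)

lemma U_gt: "lvl q < k \<Longrightarrow> eventually (\<lambda>n. i < n \<and> par n = q) (U q)"
proof -
  assume "lvl q < k"
  then have "U q \<le> inf at_top (principal {n. 0 < n \<and> par n = q})" using U_spec by blast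
  moreover have "eventually (\<lambda>n. i < n \<and> par n = q) (inf at_top (principal {n. 0 < n \<and> par n = q}))"
    unfolding eventually_inf_principal using eventually_gt_at_top[of i] by eventually_elim simp
  ultimately show ?thesis by (rule filter_leD)
qed

lemma U_ex: "lvl q < k \<Longrightarrow> eventually P (U q) \<Longrightarrow> \<exists>n. P n"
  using U_not[of q P] by (auto intro: always_eventually)

text \<open>The demand on a new node may refer to the whole finite set of nodes chosen before, so
  conditions on all lists over older nodes are met at once. Each node is picked from a set of the
  ultrafilter at the forced parent.\<close>

lemma fusion:
  assumes Good: "\<And>V q. finite V \<Longrightarrow> lvl q < k \<Longrightarrow> eventually (Good V) (U q)"
  shows "\<exists>h. emb h \<and> (\<forall>m\<le>i. h m = m) \<and> {..i} \<subseteq> range h \<and>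
    (\<forall>n\<in>range h. i < n \<longrightarrow> Good (range h \<inter> {..<n}) n)"
proof -
  have "\<exists>h. emb h \<and> map h [0..<length [0..<Suc i]] = [0..<Suc i] \<and>
    (\<forall>m\<ge>length [0..<Suc i]. valid (map h [0..<m]) \<and> Good (set (map h [0..<m])) (h m))"
  proof (rule emb_branch)
    show "valid [0..<Suc i]" using valid_map_upt[OF emb_id, of i] by simp
    show "\<exists>n. valid (s @ [n]) \<and> Good (set s) n" if v: "valid s" for s
    proof -
      note l = lvl_qn[OF v]
      have "eventually (\<lambda>n. Good (set s) n \<and> last s < n \<and> par n = qn s) (U (qn s))"
        using Good[OF finite_set l] U_gt[OF l] by (rule eventually_conj)
      from U_ex[OF l this] show ?thesis using valid_snoc[OF v] by auto
    qed
  qed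
  then obtain h where h: "emb h" "map h [0..<Suc i] = [0..<Suc i]"
    and G: "\<And>m. Suc i \<le> m \<Longrightarrow> Good (h ` {0..<m}) (h m)" by (auto simp del: upt_Suc)
  have fx: "h m = m" if "m \<le> i" for m
    using arg_cong[OF h(2), of "\<lambda>s. s ! m"] that by (simp del: upt_Suc)
  have 1: "{..i} \<subseteq> range h" using fx by (metis atMost_iff rangeI subsetI)
  have 2: "Good (range h \<inter> {..<n}) n" if n: "n \<in> range h" "i < n" for n
  proof -
    obtain m where m: "n = h m" using n(1) by blast
    then have "Suc i \<le> m" using fx[of m] n(2) by (cases "m \<le> i") auto
    moreover have "range h \<inter> {..<n} = h ` {0..<m}"
      by (auto simp: m emb_less_iff[OF h(1)])
    ultimately show ?thesis using G[of m] m by simp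
  qed
  show ?thesis using h(1) fx 1 2 by blast
qed

text \<open>Declared \<open>mono\<close> so that the inductive definition of \<open>meas\<close> may
  recurse under \<open>eventually\<close>.\<close>

lemma eventually_mono_mono[mono]:
  "(\<And>x. P x \<longrightarrow> Q x) \<Longrightarrow> eventually P F \<longrightarrow> eventually Q F"
  by (auto elim: eventually_mono)

text \<open>The ultrafilters on the sets of children induce, above every node list, an iterated
  ultrafilter on the front.\<close>
inductive meas :: "nat list set \<Rightarrow> (nat list \<Rightarrow> bool) \<Rightarrow> nat list \<Rightarrow> bool"
  for F :: "nat list set" and P :: "nat list \<Rightarrow> bool" where
  leaf: "s \<in> F \<Longrightarrow> P s \<Longrightarrow> meas F P s"
| node: "s \<notin> F \<Longrightarrow> eventually (\<lambda>n. meas F P (s @ [n])) (U (qn s)) \<Longrightarrow> meas F P s"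

lemma meas_leaf: "s \<in> F \<Longrightarrow> meas F P s \<longleftrightarrow> P s"
  by (subst meas.simps) simp

lemma meas_node: "s \<notin> F \<Longrightarrow> meas F P s \<longleftrightarrow> eventually (\<lambda>n. meas F P (s @ [n])) (U (qn s))"
  by (subst meas.simps) simp

lemma eventually_tr:
  assumes "tr F s" "s \<notin> F"
  shows "eventually (\<lambda>n. i < n \<and> tr F (s @ [n])) (U (qn s))"
  using U_gt[OF lvl_qn[OF tr_valid[OF assms(1)]], of "max i (last s)"]
  by eventually_elim (use assms valid_ne[OF tr_valid[OF assms(1)]] in \<open>simp add: tr_snoc\<close>)

text \<open>The iterated filter is again an ultrafilter: at a leaf \<open>meas\<close> is the
  predicate itself, and a limit along an ultrafilter commutes with negation.\<close>

lemma meas_not: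
  assumes "node_front F" "tr F s"
  shows "meas F (\<lambda>a. \<not> P a) s \<longleftrightarrow> \<not> meas F P s"
  using assms
proof (induction rule: bar_induct)
  case (leaf s)
  then show ?case by (simp add: meas_leaf)
next
  case (node s)
  have "eventually (\<lambda>n. meas F (\<lambda>a. \<not> P a) (s @ [n])) (U (qn s)) \<longleftrightarrow>
      eventually (\<lambda>n. \<not> meas F P (s @ [n])) (U (qn s))"
    by (rule eventually_cong[OF eventually_tr[OF node.hyps(1,2), of 0]]) (use node.IH in auto)
  also have "\<dots> \<longleftrightarrow> \<not> eventually (\<lambda>n. meas F P (s @ [n])) (U (qn s))"
    by (rule U_not[OF lvl_qn[OF tr_valid[OF node.hyps(1)]]])
  finally show ?case using node.hyps(2) by (simp add: meas_node)
qed

lemma meas_mono: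
  assumes "meas F P s" "\<And>a. a \<in> F \<Longrightarrow> P a \<Longrightarrow> Q a"
  shows "meas F Q s"
  using assms(1)
proof induction
  case (leaf s)
  then show ?case using assms(2) by (simp add: meas_leaf)
next
  case (node s)
  then show ?case by (auto simp: meas_node elim: eventually_mono)
qed

text \<open>The ultrafilters are nonprincipal, so almost every node exceeds \<open>i\<close> at each
  step; extensions through smaller nodes carry no weight.\<close>

lemma meas_all:
  assumes "node_front F" "tr F s"
    and "\<And>a. a \<in> F \<Longrightarrow> prefix s a \<Longrightarrow> set (drop (length s) a) \<subseteq> {i<..} \<Longrightarrow> P a"
  shows "meas F P s"
  using assms
proof (induction rule: bar_induct)
  case (leaf s)
  then show ?case by (simp add: meas_leaf)
next
  case (node s)
  have "eventually (\<lambda>n. meas F P (s @ [n])) (U (qn s))"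
    using eventually_tr[OF node.hyps(1,2), of i]
  proof eventually_elim
    case (elim n)
    show ?case
    proof (rule node.IH)
      show "tr F (s @ [n])" using elim by simp
      fix a assume a: "a \<in> F" "prefix (s @ [n]) a" "set (drop (length (s @ [n])) a) \<subseteq> {i<..}"
      then obtain z where "a = s @ n # z" by (auto simp: prefix_def)
      then show "P a" using a elim by (intro node.prems) auto
    qed
  qed
  then show ?case using node.hyps(2) by (simp add: meas_node)
qed

lemma finite_trs: "finite V \<Longrightarrow> finite {s. set s \<subseteq> V \<and> tr F s}"
proof -
  assume V: "finite V"
  have "distinct s" if "tr F s" for s
    using tr_valid[OF that] strict_sorted_iff by (auto simp: valid_def)
  then show ?thesis
    by (intro finite_subset[OF _ finite_subset_distinct[OF V]]) auto
qed

text \<open>A node with parent \<open>q\<close> can only prolong lists \<open>s\<close> with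
  \<open>qn s = q\<close>, and there are finitely many of these over \<open>V\<close>.\<close>

lemma eventually_trs:
  assumes "finite V" "lvl q < k"
    and "\<And>s. set s \<subseteq> V \<Longrightarrow> tr F s \<Longrightarrow> s \<notin> F \<Longrightarrow> qn s = q \<Longrightarrow> eventually (R s) (U q)"
  shows "eventually (\<lambda>n. \<forall>s. s \<noteq> [] \<longrightarrow> set s \<subseteq> V \<longrightarrow> tr F (s @ [n]) \<longrightarrow> R s n) (U q)"
proof -
  let ?A = "{s. set s \<subseteq> V \<and> tr F s \<and> s \<notin> F \<and> qn s = q}"
  have "finite ?A" by (rule finite_subset[OF _ finite_trs[OF assms(1), of F]]) auto
  then have "eventually (\<lambda>n. \<forall>s\<in>?A. R s n) (U q)"
    by (rule eventually_ball_finite) (use assms(3) in auto)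
  then show ?thesis using U_gt[OF assms(2), of 0]
    by eventually_elim (auto simp: tr_snoc)
qed

text \<open>A Nash-Williams dichotomy: fusion picks each new node so that it preserves the verdict
  of \<open>meas\<close> on all lists over older nodes. The verdict at \<open>[0]\<close> thus
  reaches the front, where it is the truth value of \<open>P\<close>.\<close>

lemma homogeneous:
  assumes F: "node_front F"
  obtains h where "emb h"
    "(\<forall>a\<in>F. set a \<subseteq> range h \<longrightarrow> P a) \<or> (\<forall>a\<in>F. set a \<subseteq> range h \<longrightarrow> \<not> P a)"
proof -
  define Good where "Good V n \<longleftrightarrow> (\<forall>s. s \<noteq> [] \<longrightarrow> set s \<subseteq> V \<longrightarrow> tr F (s @ [n]) \<longrightarrow>
    (meas F P (s @ [n]) \<longleftrightarrow> meas F P s))" for V n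
  have ev: "eventually (Good V) (U q)" if "finite V" "lvl q < k" for V q
    unfolding Good_def
  proof (rule eventually_trs[OF that])
    fix s assume s: "tr F s" "s \<notin> F" "qn s = q"
    then show "eventually (\<lambda>n. meas F P (s @ [n]) \<longleftrightarrow> meas F P s) (U q)"
      using meas_node[of s F P] U_not[OF that(2), of "\<lambda>n. meas F P (s @ [n])"]
      by (cases "meas F P s") auto
  qed
  from fusion[of Good 0, OF ev] obtain h where "emb h \<and> (\<forall>m\<le>0. h m = m) \<and> {..0} \<subseteq> range h \<and>
    (\<forall>n\<in>range h. 0 < n \<longrightarrow> Good (range h \<inter> {..<n}) n)" ..
  then have h: "emb h" "\<And>n. n \<in> range h \<Longrightarrow> 0 < n \<Longrightarrow> Good (range h \<inter> {..<n}) n" by auto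
  have *: "meas F P a \<longleftrightarrow> meas F P [0]" if "tr F a" "set a \<subseteq> range h" for a
    using that
  proof (induction a rule: rev_induct)
    case Nil
    then show ?case by (simp add: tr_def valid_def)
  next
    case (snoc x s)
    show ?case
    proof (cases "s = []")
      case True
      then show ?thesis using snoc.prems by (simp add: tr_def valid_def)
    next
      case False
      then have s: "tr F s" "last s < x" using snoc.prems(1) by (auto simp: tr_snoc)
      then have "set s \<subseteq> range h \<inter> {..<x}"
        using snoc.prems(2) valid_le_last[OF tr_valid[OF s(1)]] by fastforce
      then have "meas F P (s @ [x]) \<longleftrightarrow> meas F P s"
        using h(2)[of x] snoc.prems s False unfolding Good_def by auto
      then show ?thesis using snoc.IH s snoc.prems by simp
    qed
  qed
  have "P a \<longleftrightarrow> meas F P [0]" if "a \<in> F" "set a \<subseteq> range h" for a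
    using *[OF front_tr[OF F that(1)] that(2)] meas_leaf[OF that(1), of P] by simp
  then show ?thesis by (intro that[OF h(1)]) auto
qed

end

section \<open>Deciding separation\<close>

context node_tree
begin

text \<open>New nodes have to exceed \<open>i\<close> so that separation is inherited by subtrees
  fixing the nodes up to \<open>i\<close>.\<close>

definition sep :: "nat list set \<Rightarrow> (nat list \<Rightarrow> 'c) \<Rightarrow> nat \<Rightarrow> nat list \<Rightarrow> nat list \<Rightarrow> bool" where
  "sep F cl i s t \<longleftrightarrow> (\<forall>a\<in>F. \<forall>b\<in>F. prefix s a \<longrightarrow> prefix t b \<longrightarrow>
     set (drop (length s) a) \<subseteq> {i<..} \<longrightarrow> set (drop (length t) b) \<subseteq> {i<..} \<longrightarrow> cl a \<noteq> cl b)"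

definition low_pair :: "nat \<Rightarrow> nat list \<Rightarrow> nat list \<Rightarrow> bool" where
  "low_pair i s t \<longleftrightarrow> valid s \<and> valid t \<and> set s \<subseteq> {..i} \<and> set t \<subseteq> {..i}"

definition decided_at :: "nat list set \<Rightarrow> (nat list \<Rightarrow> 'c) \<Rightarrow> nat \<Rightarrow> bool" where
  "decided_at F cl i \<longleftrightarrow> (\<forall>s t h. low_pair i s t \<longrightarrow> emb h \<longrightarrow> (\<forall>m\<le>i. h m = m) \<longrightarrow>
     sep (pull h F) (\<lambda>a. cl (map h a)) i s t \<longrightarrow> sep F cl i s t)"

definition decided :: "nat list set \<Rightarrow> (nat list \<Rightarrow> 'c) \<Rightarrow> bool" where
  "decided F cl \<longleftrightarrow> (\<forall>i. decided_at F cl i)"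

lemma sep_pull:
  assumes h: "emb h" "\<forall>m\<le>i. h m = m" and st: "low_pair i s t" and sep: "sep F cl i s t"
  shows "sep (pull h F) (\<lambda>a. cl (map h a)) i s t"
proof -
  have *: "prefix u (map h a) \<and> set (drop (length u) (map h a)) \<subseteq> {i<..}"
    if u: "set u \<subseteq> {..i}" "prefix u a" "set (drop (length u) a) \<subseteq> {i<..}" for u a
  proof -
    obtain z where a: "a = u @ z" using u(2) by (auto simp: prefix_def)
    have "map h u = u" using u(1) h(2) by (auto intro!: map_idI)
    moreover have "i < h x" if "x \<in> set z" for x
    proof -
      have "i < x" using that u(3) by (auto simp: a)
      then show ?thesis using emb_ge[OF h(1), of x] by linarith
    qed
    ultimately show ?thesis by (auto simp: a)
  qed
  show ?thesis
    unfolding sep_def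
  proof (intro ballI impI)
    fix a b assume ab: "a \<in> pull h F" "b \<in> pull h F" "prefix s a" "prefix t b"
      "set (drop (length s) a) \<subseteq> {i<..}" "set (drop (length t) b) \<subseteq> {i<..}"
    then show "cl (map h a) \<noteq> cl (map h b)"
      using sep *[of s a] *[of t b] st by (simp add: sep_def pull_def low_pair_def)
  qed
qed

lemma finite_low: "finite {(s, t). low_pair i s t}"
proof (rule finite_subset)
  let ?L = "{s. set s \<subseteq> {..i} \<and> tr {} s}"
  show "{(s, t). low_pair i s t} \<subseteq> ?L \<times> ?L" by (auto simp: low_pair_def tr_def)
  show "finite (?L \<times> ?L)" by (intro finite_cartesian_product finite_trs) auto
qed

text \<open>Finitely many pairs live on the nodes up to \<open>i\<close>, and a subtree fixing these
  nodes can only add separated pairs. A subtree with the greatest number of them is decided.\<close>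

lemma decided_step:
  "\<exists>h. emb h \<and> (\<forall>m\<le>i. h m = m) \<and> decided_at (pull h F) (\<lambda>a. cl (map h a)) i"
proof -
  define A where "A h = {(s, t). low_pair i s t \<and> sep (pull h F) (\<lambda>a. cl (map h a)) i s t}" for h
  let ?Q = "\<lambda>h. emb h \<and> (\<forall>m\<le>i. h m = m)"
  have fin: "finite (A h)" for h
    by (rule finite_subset[OF _ finite_low[of i]]) (auto simp: A_def)
  have bd: "card (A h) < Suc (card {(s, t). low_pair i s t})" for h
    by (rule le_imp_less_Suc, rule card_mono[OF finite_low]) (auto simp: A_def)
  have "?Q (\<lambda>x. x)" by (simp add: emb_id)
  then have "\<exists>h. ?Q h \<and> (\<forall>h'. ?Q h' \<longrightarrow> card (A h') \<le> card (A h))"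
    by (rule ex_has_greatest_nat[where P = ?Q and f = "\<lambda>h. card (A h)"]) (use bd in auto)
  then obtain h where h: "emb h" "\<forall>m\<le>i. h m = m"
    and mx: "\<And>h'. ?Q h' \<Longrightarrow> card (A h') \<le> card (A h)" by blast
  have "decided_at (pull h F) (\<lambda>a. cl (map h a)) i"
    unfolding decided_at_def
  proof (intro allI impI)
    fix s t h' assume st: "low_pair i s t" and h': "emb h'" "\<forall>m\<le>i. h' m = m"
      and sep: "sep (pull h' (pull h F)) (\<lambda>a. cl (map h (map h' a))) i s t"
    let ?h = "\<lambda>x. h (h' x)"
    have eq: "pull h' (pull h F) = pull ?h F" using pull_comp[OF h'(1)] .
    have "A h \<subseteq> A ?h"
      using sep_pull[OF h', of _ _ "pull h F" "\<lambda>a. cl (map h a)"]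
      by (auto simp: A_def eq comp_def)
    moreover have "card (A ?h) \<le> card (A h)"
      using mx[of ?h] h h' emb_comp by auto
    ultimately have "A h = A ?h" using fin by (meson card_seteq)
    moreover have "(s, t) \<in> A ?h" using st sep by (simp add: A_def eq comp_def)
    ultimately have "(s, t) \<in> A h" by simp
    then show "sep (pull h F) (\<lambda>a. cl (map h a)) i s t" by (simp add: A_def)
  qed
  with h show ?thesis by blast
qed

lemma decided_at_pull:
  assumes dec: "decided_at F cl i" and H: "emb H" "\<forall>m\<le>i. H m = m"
  shows "decided_at (pull H F) (\<lambda>a. cl (map H a)) i"
  unfolding decided_at_def
proof (intro allI impI)
  fix s t h assume st: "low_pair i s t" and h: "emb h" "\<forall>m\<le>i. h m = m"
    and sep: "sep (pull h (pull H F)) (\<lambda>a. cl (map H (map h a))) i s t"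
  have "sep F cl i s t"
    using dec[unfolded decided_at_def, rule_format, of s t "\<lambda>x. H (h x)"] st emb_comp[OF H(1) h(1)]
      H(2) h(2) sep by (simp add: pull_comp[OF h(1)] comp_def)
  then show "sep (pull H F) (\<lambda>a. cl (map H a)) i s t" by (rule sep_pull[OF H st])
qed

lemma emb_factor:
  assumes "emb g" "emb G" "range G \<subseteq> range g"
  shows "\<exists>H. emb H \<and> (\<forall>x. G x = g (H x))"
proof -
  define H where "H x = inv g (G x)" for x
  have gH: "g (H x) = G x" for x using assms(3) by (auto simp: H_def intro!: f_inv_into_f)
  have "emb H"
    unfolding emb_def
  proof (intro conjI allI)
    show "strict_mono H"
      using emb_less_iff[OF assms(1)] emb_less_iff[OF assms(2)] gH by (metis strict_mono_def)
    show "H 0 = 0" using gH[of 0] assms emb_eq_iff[OF assms(1), of "H 0" 0] by (simp add: emb_def)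
    show "par (H n) = H (par n)" for n
    proof -
      have "g (par (H n)) = par (g (H n))" using assms(1) by (simp add: emb_def)
      also have "\<dots> = G (par n)" using assms(2) by (simp add: gH emb_def)
      finally have "g (par (H n)) = g (H (par n))" by (simp add: gH)
      then show ?thesis by (simp add: emb_eq_iff[OF assms(1)])
    qed
  qed
  with gH show ?thesis by metis
qed

text \<open>Stage \<open>n\<close> decides the pairs on the nodes up to \<open>n\<close> without
  moving these nodes. The diagonal embedding factors through stage \<open>Suc i\<close> by an
  embedding that fixes the nodes up to \<open>i\<close>, and this preserves being decided at
  \<open>i\<close>.\<close>

lemma decided_exists: "\<exists>g. emb g \<and> decided (pull g F) (\<lambda>a. cl (map g a))"
proof -
  define Q where "Q n g g' \<longleftrightarrow> (\<exists>h. emb h \<and> (\<forall>m\<le>n. h m = m) \<and> g' = (\<lambda>x. g (h x))) \<and>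
    decided_at (pull g' F) (\<lambda>a. cl (map g' a)) n" for n and g g' :: "nat \<Rightarrow> nat"
  have "\<exists>f. \<forall>n. emb (f n) \<and> Q n (f n) (f (Suc n))"
  proof (rule dependent_nat_choice)
    show "\<exists>g. emb g" using emb_id by blast
    fix g n assume g: "emb g"
    obtain h where h: "emb h" "\<forall>m\<le>n. h m = m"
      "decided_at (pull h (pull g F)) (\<lambda>a. cl (map g (map h a))) n"
      using decided_step[of n "pull g F" "\<lambda>a. cl (map g a)"] by blast
    have "Q n g (\<lambda>x. g (h x))"
      using h unfolding Q_def by (auto simp: pull_comp[OF h(1)] comp_def)
    then show "\<exists>g'. emb g' \<and> Q n g g'" using emb_comp[OF g h(1)] by blast
  qed
  then obtain f where ff: "\<forall>n. emb (f n) \<and> Q n (f n) (f (Suc n))" ..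
  then have f: "emb (f n)" and Q: "Q n (f n) (f (Suc n))" for n by auto
  have fS: "f (Suc n) m = f n m" if "m \<le> n" for n m
    using Q[of n] that unfolding Q_def by auto
  have rS: "range (f (Suc n)) \<subseteq> range (f n)" for n
    using Q[of n] unfolding Q_def by auto
  have stable: "f j m = f n m" if "m \<le> n" "n \<le> j" for m n j
    using that(2) by (induction rule: dec_induct) (use that(1) fS in auto)
  have ran: "range (f j) \<subseteq> range (f n)" if "n \<le> j" for n j
    using that by (induction rule: dec_induct) (use rS in blast)+
  define G where "G m = f m m" for m
  have Gf: "G m = f j m" if "m \<le> j" for m j using stable[of m m j] that by (simp add: G_def)
  have "emb G"
    unfolding emb_def
  proof (intro conjI allI)
    have "G n < G (Suc n)" for n
      using Gf[of n "Suc n"] Gf[of "Suc n" "Suc n"] emb_less_iff[OF f, of "Suc n" n "Suc n"] by simp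
    then show "strict_mono G" by (simp add: strict_mono_Suc_iff)
    show "G 0 = 0" using f[of 0] by (simp add: G_def emb_def)
    show "par (G n) = G (par n)" for n
      using Gf[of n n] Gf[of "par n" n] par_le[of n] f[of n] by (simp add: emb_def)
  qed
  moreover have "decided_at (pull G F) (\<lambda>a. cl (map G a)) i" for i
  proof -
    have "range G \<subseteq> range (f (Suc i))"
    proof
      fix y assume "y \<in> range G"
      then obtain m where "y = G m" by blast
      then have "y = f (max m (Suc i)) m" using Gf[of m "max m (Suc i)"] by simp
      then show "y \<in> range (f (Suc i))" using ran[of "Suc i" "max m (Suc i)"] by auto
    qed
    then obtain H where H: "emb H" "\<And>x. G x = f (Suc i) (H x)"
      using emb_factor[OF f \<open>emb G\<close>] by blast
    have "H m = m" if "m \<le> i" for m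
      using H(2)[of m] Gf[of m "Suc i"] that emb_eq_iff[OF f, of "Suc i" m "H m"] by simp
    moreover have "decided_at (pull (f (Suc i)) F) (\<lambda>a. cl (map (f (Suc i)) a)) i"
      using Q[of i] by (simp add: Q_def)
    ultimately have "decided_at (pull H (pull (f (Suc i)) F)) (\<lambda>a. cl (map (f (Suc i)) (map H a))) i"
      using H(1) by (intro decided_at_pull[where cl = "\<lambda>a. cl (map (f (Suc i)) a)"]) auto
    moreover have "(\<lambda>x. f (Suc i) (H x)) = G" using H(2) by auto
    ultimately show ?thesis by (simp add: pull_comp[OF H(1)] comp_def)
  qed
  ultimately show ?thesis unfolding decided_def by blast
qed

end

section \<open>Mixing and recorded nodes\<close>

locale decided_front = node_tree par lvl k for par lvl :: "nat \<Rightarrow> nat" and k :: nat +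
  fixes F :: "nat list set" and cl :: "nat list \<Rightarrow> 'c"
  assumes front: "node_front F" and dec: "decided F cl"
begin

abbreviation T :: "nat list \<Rightarrow> bool" where "T \<equiv> tr F"

definition mix :: "nat list \<Rightarrow> nat list \<Rightarrow> bool" where
  "mix s t \<longleftrightarrow> (\<forall>Q. meas F (\<lambda>a. cl a \<in> Q) s \<longleftrightarrow> meas F (\<lambda>a. cl a \<in> Q) t)"

text \<open>A property of the list before the new node arrives: whether the next node is recorded
  does not depend on which node is taken.\<close>

definition recd :: "nat list \<Rightarrow> bool" where
  "recd s \<longleftrightarrow> s \<notin> F \<and> \<not> eventually (\<lambda>n. mix s (s @ [n])) (U (qn s))"

definition D :: "nat list \<Rightarrow> nat set" where
  "D a = {n. \<exists>c. c \<noteq> [] \<and> recd c \<and> prefix (c @ [n]) a}"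

lemma mix_refl[simp]: "mix s s"
  by (simp add: mix_def)

lemma mix_sym: "mix s t \<Longrightarrow> mix t s"
  by (simp add: mix_def)

lemma mix_trans: "mix s t \<Longrightarrow> mix t u \<Longrightarrow> mix s u"
  by (simp add: mix_def)

lemma recd_not_F: "recd s \<Longrightarrow> s \<notin> F"
  by (simp add: recd_def)

lemma T_ne: "T s \<Longrightarrow> s \<noteq> []"
  by (simp add: tr_def valid_def)

lemma lvl_T: "T s \<Longrightarrow> lvl (qn s) < k"
  by (simp add: lvl_qn tr_def)

lemma mix_front: "a \<in> F \<Longrightarrow> b \<in> F \<Longrightarrow> mix a b \<longleftrightarrow> cl a = cl b"
  by (auto simp: mix_def meas_leaf)

text \<open>The class ultrafilter at \<open>s\<close> is the limit of those at its prolongations,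
  and a limit of an almost constant family is that constant.\<close>

lemma mix_integrate:
  assumes "T s" "s \<notin> F" "eventually (\<lambda>n. mix t (s @ [n])) (U (qn s))"
  shows "mix t s"
  unfolding mix_def
proof
  fix Q
  let ?m = "meas F (\<lambda>a. cl a \<in> Q)"
  have "?m s \<longleftrightarrow> eventually (\<lambda>n. ?m (s @ [n])) (U (qn s))"
    by (rule meas_node[OF assms(2)])
  also have "\<dots> \<longleftrightarrow> eventually (\<lambda>n. ?m t) (U (qn s))"
    by (rule eventually_cong[OF assms(3)]) (simp add: mix_def)
  also have "\<dots> \<longleftrightarrow> ?m t"
    using U_not[OF lvl_T[OF assms(1)], of "\<lambda>_. ?m t"] by (cases "?m t") auto
  finally show "?m t \<longleftrightarrow> ?m s" by simp
qed

lemma sync_integrate: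
  assumes "s \<notin> F" "t \<notin> F" "qn s = qn t"
    "eventually (\<lambda>n. mix (s @ [n]) (t @ [n])) (U (qn s))"
  shows "mix s t"
  unfolding mix_def
proof
  fix Q
  let ?m = "meas F (\<lambda>a. cl a \<in> Q)"
  have "eventually (\<lambda>n. ?m (s @ [n])) (U (qn s)) \<longleftrightarrow> eventually (\<lambda>n. ?m (t @ [n])) (U (qn s))"
    by (rule eventually_cong[OF assms(4)]) (simp add: mix_def)
  then show "?m s \<longleftrightarrow> ?m t" using assms by (simp add: meas_node)
qed

text \<open>Recording is defined with \<open>s\<close> alone but concerns every list: if
  \<open>t\<close> mixed with almost all prolongations, it would mix with their limit
  \<open>s\<close>, and by transitivity \<open>s\<close> would mix with almost all of them.\<close>

lemma recd_eventually:
  assumes "T s" "recd s"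
  shows "eventually (\<lambda>n. \<not> mix t (s @ [n])) (U (qn s))"
proof (rule ccontr)
  assume "\<not> eventually (\<lambda>n. \<not> mix t (s @ [n])) (U (qn s))"
  then have ev: "eventually (\<lambda>n. mix t (s @ [n])) (U (qn s))"
    using U_not[OF lvl_T[OF assms(1)], of "\<lambda>n. mix t (s @ [n])"] by blast
  then have "mix s t" using mix_integrate assms recd_not_F mix_sym by blast
  then have "eventually (\<lambda>n. mix s (s @ [n])) (U (qn s))"
    using ev by (auto elim: eventually_mono intro: mix_trans)
  then show False using assms(2) by (simp add: recd_def)
qed

lemma D_snoc: "s \<noteq> [] \<Longrightarrow> D (s @ [n]) = D s \<union> (if recd s then {n} else {})"
  by (auto simp: D_def)

lemma D_0[simp]: "D [x] = {}"
  by (auto simp: D_def prefix_Cons)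

lemma D_subset: "D a \<subseteq> set a"
  by (auto simp: D_def prefix_def)

lemma D_pos: "T a \<Longrightarrow> n \<in> D a \<Longrightarrow> 0 < n"
proof -
  assume a: "T a" and "n \<in> D a"
  then obtain c where c: "c \<noteq> []" "prefix (c @ [n]) a" by (auto simp: D_def)
  then have "T (c @ [n])" using tr_prefix[OF a] by simp
  then show "0 < n" using c(1) by (auto simp: tr_snoc)
qed

section \<open>Generic sets of nodes and tracing of recorded nodes\<close>

definition has_child :: "nat \<Rightarrow> nat list \<Rightarrow> bool" where
  "has_child x a \<longleftrightarrow> (\<exists>y\<in>D a. par y = x)"

text \<open>Typical behaviour of a new node towards all lists over the older nodes \<open>V\<close>.
  The first two clauses govern unrecorded and recorded positions, the third passes between one
  common prolongation and almost all of them, and the fourth carries predictions about recorded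
  children up to the front.\<close>

definition Good :: "nat set \<Rightarrow> nat \<Rightarrow> bool" where
  "Good V n \<longleftrightarrow> (\<forall>s. s \<noteq> [] \<longrightarrow> set s \<subseteq> V \<longrightarrow> T (s @ [n]) \<longrightarrow>
     (\<not> recd s \<longrightarrow> mix s (s @ [n])) \<and>
     (\<forall>t\<in>{t. set t \<subseteq> V \<and> T t}. recd s \<longrightarrow> \<not> mix t (s @ [n])) \<and>
     (\<forall>t\<in>{t. set t \<subseteq> V \<and> T t}. mix (s @ [n]) (t @ [n]) \<longleftrightarrow>
        eventually (\<lambda>m. mix (s @ [m]) (t @ [m])) (U (qn s))) \<and>
     (\<forall>x\<in>V. meas F (has_child x) (s @ [n]) \<longleftrightarrow> meas F (has_child x) s))"

lemma eventually_decide: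
  "lvl q < k \<Longrightarrow> eventually (\<lambda>n. P n \<longleftrightarrow> eventually P (U q)) (U q)"
  using U_not[of q P] by (cases "eventually P (U q)") auto

lemma eventually_Good:
  assumes "finite V" "lvl q < k"
  shows "eventually (Good V) (U q)"
  unfolding Good_def
proof (rule eventually_trs[OF assms])
  fix s assume s: "set s \<subseteq> V" "T s" "s \<notin> F" "qn s = q"
  have fin: "finite {t. set t \<subseteq> V \<and> T t}" by (rule finite_trs[OF assms(1)])
  show "eventually (\<lambda>n. (\<not> recd s \<longrightarrow> mix s (s @ [n])) \<and>
     (\<forall>t\<in>{t. set t \<subseteq> V \<and> T t}. recd s \<longrightarrow> \<not> mix t (s @ [n])) \<and>
     (\<forall>t\<in>{t. set t \<subseteq> V \<and> T t}. mix (s @ [n]) (t @ [n]) \<longleftrightarrow>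
        eventually (\<lambda>m. mix (s @ [m]) (t @ [m])) (U (qn s))) \<and>
     (\<forall>x\<in>V. meas F (has_child x) (s @ [n]) \<longleftrightarrow> meas F (has_child x) s)) (U q)"
  proof (intro eventually_conj eventually_ball_finite[OF fin] eventually_ball_finite[OF assms(1)] ballI)
    show "eventually (\<lambda>n. \<not> recd s \<longrightarrow> mix s (s @ [n])) (U q)"
      using s by (cases "recd s") (simp_all add: recd_def)
    show "eventually (\<lambda>n. recd s \<longrightarrow> \<not> mix t (s @ [n])) (U q)" for t
      using s recd_eventually[of s t] by (cases "recd s") simp_all
    show "eventually (\<lambda>n. mix (s @ [n]) (t @ [n]) \<longleftrightarrow>
        eventually (\<lambda>m. mix (s @ [m]) (t @ [m])) (U (qn s))) (U q)" for t
      using eventually_decide[OF assms(2)] s(4) by simp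
    show "eventually (\<lambda>n. meas F (has_child x) (s @ [n]) \<longleftrightarrow> meas F (has_child x) s) (U q)" for x
      using eventually_decide[OF assms(2), of "\<lambda>n. meas F (has_child x) (s @ [n])"]
        meas_node[OF s(3), of "has_child x"] s(4) by simp
  qed
qed

text \<open>Nodes up to \<open>i\<close> are exempt from the demand: they may occur in the given
  lists whose mixing is being examined.\<close>

definition gen :: "nat \<Rightarrow> nat set \<Rightarrow> bool" where
  "gen i S \<longleftrightarrow> {..i} \<subseteq> S \<and> (\<forall>n\<in>S. i < n \<longrightarrow> Good (S \<inter> {..<n}) n)"

lemma gen_exists: "\<exists>h. emb h \<and> (\<forall>m\<le>i. h m = m) \<and> gen i (range h)"
  using fusion[of Good i, OF eventually_Good] by (simp add: gen_def)

definition ext :: "nat \<Rightarrow> nat set \<Rightarrow> nat list \<Rightarrow> nat list \<Rightarrow> bool" where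
  "ext i S s a \<longleftrightarrow> T s \<and> T a \<and> prefix s a \<and> set s \<subseteq> {..i} \<and> set (drop (length s) a) \<subseteq> S \<inter> {i<..}"

lemma ext_prefix: "ext i S s a \<Longrightarrow> prefix s c \<Longrightarrow> prefix c a \<Longrightarrow> ext i S s c"
proof -
  assume e: "ext i S s a" and p: "prefix s c" "prefix c a"
  have "c \<noteq> []" using e p(1) T_ne by (auto simp: ext_def)
  then have "T c" using e p(2) tr_prefix by (auto simp: ext_def)
  moreover have "set (drop (length s) c) \<subseteq> set (drop (length s) a)"
    using p by (auto simp: prefix_def)
  ultimately show ?thesis using e p(1) by (auto simp: ext_def)
qed

lemma ext_set: "gen i S \<Longrightarrow> ext i S s a \<Longrightarrow> set a \<subseteq> S"
proof -
  assume g: "gen i S" and e: "ext i S s a"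
  then obtain z where z: "a = s @ z" by (auto simp: ext_def prefix_def)
  have "set s \<subseteq> {..i}" "set z \<subseteq> S" using e by (auto simp: ext_def z)
  moreover have "{..i} \<subseteq> S" using g by (simp add: gen_def)
  ultimately show ?thesis unfolding z set_append by (intro Un_least) (rule order_trans)
qed

lemma ext_snocD:
  assumes "gen i S" "ext i S s (a @ [n])" "a @ [n] \<noteq> s"
  shows "ext i S s a" "n \<in> S" "i < n" "a \<noteq> []" "T a" "T (a @ [n])" "a \<notin> F" "set a \<subseteq> S \<inter> {..<n}"
proof -
  have p: "prefix s a" using assms(2,3) by (simp add: ext_def)
  show e: "ext i S s a" by (rule ext_prefix[OF assms(2) p]) simp
  show a: "a \<noteq> []" "T a" using e T_ne by (auto simp: ext_def)
  show t: "T (a @ [n])" using assms(2) by (simp add: ext_def)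
  show "a \<notin> F" using t a by (simp add: tr_snoc)
  show "n \<in> S" "i < n" using assms(2) p by (auto simp: ext_def prefix_def)
  have "x < n" if "x \<in> set a" for x
    using valid_le_last[OF tr_valid[OF a(2)] that] t a by (simp add: tr_snoc)
  then show "set a \<subseteq> S \<inter> {..<n}" using ext_set[OF assms(1) e] by auto
qed

lemma gen_rules:
  assumes g: "gen i S" and e: "ext i S s (a @ [n])" "a @ [n] \<noteq> s"
  shows "\<not> recd a \<Longrightarrow> mix a (a @ [n])"
    and "set t \<subseteq> S \<inter> {..<n} \<Longrightarrow> T t \<Longrightarrow> recd a \<Longrightarrow> \<not> mix t (a @ [n])"
    and "set t \<subseteq> S \<inter> {..<n} \<Longrightarrow> T t \<Longrightarrow> mix (a @ [n]) (t @ [n]) \<longleftrightarrow>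
        eventually (\<lambda>m. mix (a @ [m]) (t @ [m])) (U (qn a))"
    and "x \<in> S \<Longrightarrow> x < n \<Longrightarrow> meas F (has_child x) (a @ [n]) \<longleftrightarrow> meas F (has_child x) a"
proof -
  note a = ext_snocD[OF g e]
  have G: "Good (S \<inter> {..<n}) n" using g a by (simp add: gen_def)
  note G' = G[unfolded Good_def, rule_format, OF a(4) a(8) a(6)]
  show "\<not> recd a \<Longrightarrow> mix a (a @ [n])" using G' by blast
  show "set t \<subseteq> S \<inter> {..<n} \<Longrightarrow> T t \<Longrightarrow> recd a \<Longrightarrow> \<not> mix t (a @ [n])" using G' by blast
  show "set t \<subseteq> S \<inter> {..<n} \<Longrightarrow> T t \<Longrightarrow> mix (a @ [n]) (t @ [n]) \<longleftrightarrow>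
        eventually (\<lambda>m. mix (a @ [m]) (t @ [m])) (U (qn a))" using G' by blast
  show "x \<in> S \<Longrightarrow> x < n \<Longrightarrow> meas F (has_child x) (a @ [n]) \<longleftrightarrow> meas F (has_child x) a"
    using G' by blast
qed

text \<open>Two mixed node lists can be traced back in parallel: unrecorded nodes are stripped off, and
  the last recorded nodes agree because the larger one was chosen to avoid mixing with anything below it.\<close>
lemma trace:
  assumes g: "gen i S"
  shows "ext i S s a \<Longrightarrow> ext i S t b \<Longrightarrow> mix a b \<Longrightarrow> prefix s c \<Longrightarrow> prefix (c @ [n]) a \<Longrightarrow> recd c
    \<Longrightarrow> \<exists>d. prefix t d \<and> prefix (d @ [n]) b \<and> recd d \<and> mix (c @ [n]) (d @ [n])"
proof (induction "length a + length b" arbitrary: a b rule: less_induct)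
  case less
  note ea = less.prems(1) and eb = less.prems(2) and ab = less.prems(3)
  have "a \<noteq> s" using less.prems(4,5) by (auto simp: prefix_def)
  moreover obtain a' x where a: "a = a' @ [x]"
    using T_ne[of a] ea by (cases a rule: rev_cases) (auto simp: ext_def)
  ultimately have as: "a' @ [x] \<noteq> s" by simp
  note A = ext_snocD[OF g ea[unfolded a] as] and GA = gen_rules[OF g ea[unfolded a] as]
  show ?case
  proof (cases "recd a'")
    case False
    then have "mix a' b" using GA(1) ab a mix_trans mix_sym by blast
    moreover have "prefix (c @ [n]) a'" using less.prems(5,6) False by (auto simp: a)
    ultimately show ?thesis using less.hyps[of a' b] A(1) eb less.prems by (simp add: a)
  next
    case ra: True
    show ?thesis
    proof (cases "b = t")
      case True
      \<comment> \<open>The nodes of \<open>t\<close> are at most \<open>i < x\<close>, so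
        \<open>x\<close>, being recorded, was chosen to avoid mixing with \<open>t\<close>:
        \<open>b\<close> must contain a new node.\<close>
      have "set t \<subseteq> S \<inter> {..<x}" "T t" using eb g A(3) by (auto simp: ext_def gen_def)
      then show ?thesis using GA(2)[of t] ra ab a True mix_sym by blast
    next
      case bt: False
      obtain b' y where b: "b = b' @ [y]"
        using T_ne[of b] eb by (cases b rule: rev_cases) (auto simp: ext_def)
      have bs: "b' @ [y] \<noteq> t" using bt b by simp
      note B = ext_snocD[OF g eb[unfolded b] bs] and GB = gen_rules[OF g eb[unfolded b] bs]
      show ?thesis
      proof (cases "recd b'")
        case False
        then have "mix a b'" using GB(1) ab b mix_trans mix_sym by blast
        then show ?thesis using less.hyps[of a b'] B(1) ea less.prems by (auto simp: b)
      next
        case rb: True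
        have "\<not> y < x"
        proof
          assume "y < x"
          then have "set b \<subseteq> S \<inter> {..<x}" using B(2,8) by (auto simp: b)
          then show False using GA(2)[of b] B(6) ra ab mix_sym by (simp add: a b)
        qed
        moreover have "\<not> x < y"
        proof
          assume "x < y"
          then have "set a \<subseteq> S \<inter> {..<y}" using A(2,8) by (auto simp: a)
          then show False using GB(2)[of a] A(6) rb ab by (simp add: a b)
        qed
        ultimately have xy: "x = y" by simp
        show ?thesis
        proof (cases "c = a'")
          case True
          then have "n = x" using less.prems(5) by (auto simp: a prefix_def)
          then show ?thesis using True rb ab B(1) by (intro exI[of _ b']) (auto simp: a b xy ext_def)
        next
          case False
          then have p: "prefix (c @ [n]) a'" using less.prems(5) by (auto simp: a)
          \<comment> \<open>The common last node is typical, so almost all common prolongations mix,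
            and mixing descends to \<open>a'\<close> and \<open>b'\<close>.\<close>
          have "eventually (\<lambda>m. mix (a' @ [m]) (b' @ [m])) (U (qn a'))"
            using GA(3)[of b'] B(8,5) ab by (simp add: a b xy)
          moreover have "qn a' = qn b'" using A(4,6) B(4,6) xy by (simp add: tr_snoc)
          ultimately have "mix a' b'" using sync_integrate A(7) B(7) by blast
          then obtain d where "prefix t d" "prefix (d @ [n]) b'" "recd d" "mix (c @ [n]) (d @ [n])"
            using less.hyps[of a' b'] A(1) B(1) less.prems(4,6) p by (auto simp: a b)
          then show ?thesis by (auto simp: b)
        qed
      qed
    qed
  qed
qed

lemma ext_D_split:
  assumes "ext i S s a" "prefix (c @ [n]) a" "i < n"
  shows "prefix s c"
proof -
  have "\<not> prefix (c @ [n]) s" using assms(1,3) by (auto simp: ext_def prefix_def)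
  moreover have "prefix s a" using assms(1) by (simp add: ext_def)
  ultimately have "prefix s (c @ [n])" "s \<noteq> c @ [n]"
    using prefix_same_cases[OF assms(2), of s] by auto
  then show ?thesis by simp
qed

lemma trace_D:
  assumes g: "gen i S" and "ext i S s a" "ext i S t b" "mix a b"
  shows "D a \<inter> {i<..} = D b \<inter> {i<..}"
proof -
  have *: "n \<in> D b" if n: "n \<in> D a" "i < n" and e: "ext i S s a" "ext i S t b" "mix a b" for n s t a b
  proof -
    obtain c where c: "c \<noteq> []" "recd c" "prefix (c @ [n]) a" using n(1) by (auto simp: D_def)
    obtain d where "prefix t d" "prefix (d @ [n]) b" "recd d"
      using trace[OF g e ext_D_split[OF e(1) c(3) n(2)] c(3,2)] by blast
    moreover have "d \<noteq> []" using \<open>prefix t d\<close> e(2) T_ne by (auto simp: ext_def)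
    ultimately show ?thesis by (auto simp: D_def)
  qed
  show ?thesis
    using *[OF _ _ assms(2-4)] *[OF _ _ assms(3,2) mix_sym[OF assms(4)]] by auto
qed

text \<open>The set \<open>Q\<close> of classes reached from \<open>s\<close> through nodes beyond
  \<open>i\<close> has measure one at \<open>s\<close>, while separation gives its complement
  measure one at \<open>t\<close>.\<close>

lemma sep_not_mix:
  assumes "T s" "T t" "sep F cl i s t"
  shows "\<not> mix s t"
proof
  assume m: "mix s t"
  define Q where "Q = {cl a |a. a \<in> F \<and> prefix s a \<and> set (drop (length s) a) \<subseteq> {i<..}}"
  have "meas F (\<lambda>a. cl a \<in> Q) s"
    by (rule meas_all[OF front assms(1), of i]) (auto simp: Q_def)
  then have "meas F (\<lambda>a. cl a \<in> Q) t" using m by (simp add: mix_def)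
  moreover have "meas F (\<lambda>a. \<not> cl a \<in> Q) t"
    by (rule meas_all[OF front assms(2), of i]) (use assms(3) in \<open>fastforce simp: Q_def sep_def\<close>)
  ultimately show False using meas_not[OF front assms(2), of "\<lambda>a. cl a \<in> Q"] by simp
qed

text \<open>Since the front is decided, it suffices to separate on some generic set of nodes.\<close>
lemma not_mixI:
  assumes st: "T s" "T t" "set s \<subseteq> {..i}" "set t \<subseteq> {..i}"
    and gen: "\<And>S a b. gen i S \<Longrightarrow> a \<in> F \<Longrightarrow> b \<in> F \<Longrightarrow> ext i S s a \<Longrightarrow> ext i S t b \<Longrightarrow> \<not> mix a b"
  shows "\<not> mix s t"
proof -
  obtain h where h: "emb h" "\<forall>m\<le>i. h m = m" "gen i (range h)" using gen_exists[of i] by blast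
  have lp: "low_pair i s t" using st tr_valid by (simp add: low_pair_def)
  have e: "map h a \<in> F \<and> ext i (range h) u (map h a)"
    if u: "T u" "set u \<subseteq> {..i}" and a: "a \<in> pull h F" "prefix u a" "set (drop (length u) a) \<subseteq> {i<..}" for u a
  proof -
    obtain z where z: "a = u @ z" using a(2) by (auto simp: prefix_def)
    have "map h u = u" using u(2) h(2) by (auto intro!: map_idI)
    moreover have "i < h x" if "x \<in> set z" for x
    proof -
      have "i < x" using that a(3) by (auto simp: z)
      then show ?thesis using emb_ge[OF h(1), of x] by linarith
    qed
    moreover have F: "map h a \<in> F" using a(1) by (simp add: pull_def)
    ultimately show ?thesis using u front_tr[OF front F] by (auto simp: ext_def z)
  qed
  have "sep (pull h F) (\<lambda>a. cl (map h a)) i s t"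
    unfolding sep_def
  proof (intro ballI impI)
    fix a b assume "a \<in> pull h F" "b \<in> pull h F" "prefix s a" "prefix t b"
      "set (drop (length s) a) \<subseteq> {i<..}" "set (drop (length t) b) \<subseteq> {i<..}"
    then have "map h a \<in> F" "ext i (range h) s (map h a)" "map h b \<in> F" "ext i (range h) t (map h b)"
      using e st by auto
    then show "cl (map h a) \<noteq> cl (map h b)"
      using gen[OF h(3), of "map h a" "map h b"] mix_front by auto
  qed
  then have "sep F cl i s t"
    using dec lp h by (auto simp: decided_def decided_at_def)
  then show ?thesis by (rule sep_not_mix[OF st(1,2)])
qed

lemma ext_first:
  assumes "ext i S s a" "a \<noteq> s"
  obtains n where "prefix (s @ [n]) a" "i < n"
proof -
  obtain z where z: "a = s @ z" using assms by (auto simp: ext_def prefix_def)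
  then obtain n y where "z = n # y" using assms(2) by (cases z) auto
  then show ?thesis using assms(1) by (intro that[of n]) (auto simp: ext_def z prefix_def)
qed

lemma prefix_snoc_le:
  assumes "valid a" "prefix (s @ [n]) a" "prefix s c" "prefix (c @ [m]) a"
  shows "n \<le> m" "c \<noteq> s \<Longrightarrow> n < m"
proof -
  have "c = s \<and> m = n \<or> (c \<noteq> s \<and> n < m)"
  proof (cases "c = s")
    case True
    then show ?thesis using assms(2,4) by (auto simp: prefix_def)
  next
    case False
    then obtain z x where c: "c = s @ x # z" using assms(3) by (cases "drop (length s) c") (auto simp: prefix_def)
    then have "x = n" using assms(2,4) by (auto simp: prefix_def)
    moreover have "sorted_wrt (<) (c @ [m])"
      using assms(1,4) by (auto simp: valid_def prefix_def sorted_wrt_append)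
    ultimately show ?thesis using False by (auto simp: c sorted_wrt_append)
  qed
  then show "n \<le> m" "c \<noteq> s \<Longrightarrow> n < m" by auto
qed

text \<open>Otherwise consider mixed \<open>a\<close> and \<open>b\<close> over a generic set. Their
  first new nodes \<open>n\<close> and \<open>m\<close> are both recorded, and tracing each into the
  other list forces \<open>n = m\<close>, so the parents agree. The lists up to this node mix, and
  genericity turns the single instance into almost all.\<close>

lemma recd_sync:
  assumes st: "T s" "T t" "recd s" "recd t" "mix s t"
  shows "qn s = qn t" "eventually (\<lambda>n. mix (s @ [n]) (t @ [n])) (U (qn s))"
proof -
  define i where "i = Max (set s \<union> set t)"
  have i: "set s \<subseteq> {..i}" "set t \<subseteq> {..i}" by (auto simp: i_def)
  have "qn s = qn t \<and> eventually (\<lambda>n. mix (s @ [n]) (t @ [n])) (U (qn s))"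
  proof (rule ccontr)
    assume neg: "\<not> ?thesis"
    have "\<not> mix s t"
    proof (rule not_mixI[OF st(1,2) i])
      fix S a b assume g: "gen i S" and F: "a \<in> F" "b \<in> F" and e: "ext i S s a" "ext i S t b"
      show "\<not> mix a b"
      proof
        assume ab: "mix a b"
        have "a \<noteq> s" "b \<noteq> t" using F st recd_not_F by auto
        then obtain n m where n: "prefix (s @ [n]) a" "i < n" and m: "prefix (t @ [m]) b" "i < m"
          using ext_first e by metis
        obtain d where d: "prefix t d" "prefix (d @ [n]) b" "mix (s @ [n]) (d @ [n])"
          using trace[OF g e ab _ n(1) st(3)] by auto
        obtain d' where d': "prefix s d'" "prefix (d' @ [m]) a"
          using trace[OF g e(2,1) mix_sym[OF ab] _ m(1) st(4)] by auto
        have "n \<le> m"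
          using prefix_snoc_le(1)[OF front_valid[OF front F(1)] n(1) d'] .
        then have "d = t"
          using prefix_snoc_le(2)[OF front_valid[OF front F(2)] m(1) d(1,2)] by linarith
        have ta: "T (s @ [n])" "T (t @ [n])"
          using n(1) d(2) \<open>d = t\<close> front_tr[OF front] F tr_prefix by blast+
        then have "qn s = qn t" using T_ne st by (simp add: tr_snoc)
        have ext: "ext i S s (s @ [n])" by (rule ext_prefix[OF e(1) _ n(1)]) simp
        have "set t \<subseteq> S \<inter> {..<n}" using i(2) n(2) g by (auto simp: gen_def)
        then have "eventually (\<lambda>n. mix (s @ [n]) (t @ [n])) (U (qn s))"
          using gen_rules(3)[OF g ext _ _ st(2)] d(3) \<open>d = t\<close> by simp
        with neg \<open>qn s = qn t\<close> show False by simp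
      qed
    qed
    then show False using st(5) by simp
  qed
  then show "qn s = qn t" "eventually (\<lambda>n. mix (s @ [n]) (t @ [n])) (U (qn s))" by auto
qed

lemma has_child_spread:
  assumes g: "gen i S" and "ext i S s a" "x \<le> i" "meas F (has_child x) s"
  shows "meas F (has_child x) a"
  using assms(2)
proof (induction a rule: rev_induct)
  case Nil
  then show ?case using assms(4) by (auto simp: ext_def)
next
  case (snoc n a)
  show ?case
  proof (cases "a @ [n] = s")
    case False
    note A = ext_snocD[OF g snoc.prems False]
    have "x \<in> S" "x < n" using g assms(3) A by (auto simp: gen_def)
    then show ?thesis using gen_rules(4)[OF g snoc.prems False] snoc.IH[OF A(1)] by blast
  qed (use assms(4) in auto)
qed

text \<open>An unrecorded node x could as well have been replaced by a later sibling; the two choices would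
  be separated if a child of x were recorded later on.\<close>
lemma unrecorded_no_child:
  assumes c: "T c" "c \<notin> F" "\<not> recd c" and x: "T (c @ [x])" "mix c (c @ [x])"
  shows "\<not> meas F (has_child x) (c @ [x])"
proof
  assume meas: "meas F (has_child x) (c @ [x])"
  \<comment> \<open>The position is unrecorded, so a later sibling \<open>x1\<close> serves as well:
    both prolongations mix with \<open>c\<close>, hence with each other, which is to be
    contradicted.\<close>
  have "eventually (\<lambda>n. mix c (c @ [n])) (U (qn c))" using c by (simp add: recd_def)
  from U_ex[OF lvl_T[OF c(1)] eventually_conj[OF this eventually_tr[OF c(1,2), of x]]]
  obtain x1 where x1: "mix c (c @ [x1])" "x < x1" "T (c @ [x1])" by auto
  have "x' < x" if "x' \<in> set c" for x'
    using valid_le_last[OF tr_valid[OF c(1)] that] x(1) T_ne[OF c(1)] by (simp add: tr_snoc)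
  then have cx: "set c \<subseteq> {..<x}" by auto
  have "\<not> mix (c @ [x]) (c @ [x1])"
  proof (rule not_mixI[OF x(1) x1(3), of x1])
    show "set (c @ [x]) \<subseteq> {..x1}" "set (c @ [x1]) \<subseteq> {..x1}" using cx x1(2) by auto
    fix S a b assume g: "gen x1 S" and F: "a \<in> F" "b \<in> F"
      and e: "ext x1 S (c @ [x]) a" "ext x1 S (c @ [x1]) b"
    show "\<not> mix a b"
    proof
      assume ab: "mix a b"
      have "meas F (has_child x) a" using has_child_spread[OF g e(1) _ meas] x1(2) by simp
      then have "has_child x a" using meas_leaf[OF F(1)] by simp
      then obtain y where y: "y \<in> D a" "par y = x" by (auto simp: has_child_def)
      have "0 < y" using D_pos[OF front_tr[OF front F(1)] y(1)] .
      then have "x < y" using par_less[of y] y(2) by simp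
      have "y \<in> set a" using y(1) D_subset by blast
      moreover have "y \<notin> set (c @ [x])" using cx \<open>x < y\<close> by auto
      ultimately have "x1 < y" using e(1) by (auto simp: ext_def prefix_def subset_iff)
      \<comment> \<open>As \<open>y\<close> is a new node, tracing records it in \<open>b\<close>
        too. Its parent \<open>x\<close> would then lie in \<open>b\<close>, where it was skipped in
        favour of \<open>x1\<close>.\<close>
      then have "y \<in> D b" using trace_D[OF g e ab] y(1) by auto
      then have "x \<in> set b"
        using D_subset valid_par_closed[OF front_valid[OF front F(2)], of y] y(2) by auto
      moreover have "x \<notin> set (c @ [x1])" using cx x1(2) by auto
      ultimately show False using e(2) x1(2) by (auto simp: ext_def prefix_def subset_iff)
    qed
  qed
  then show False using x(2) x1(1) mix_trans mix_sym by blast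
qed

text \<open>At a front element the class ultrafilter is a point mass. A list mixing with it carries
  the same point mass, and so do almost all its prolongations; nothing is left to record.\<close>

lemma mix_leaf:
  assumes "a \<in> F" "T t" "t \<notin> F" "mix a t"
  shows "\<not> recd t"
proof -
  have point: "mix a u" if u: "T u" "meas F (\<lambda>b. cl b \<in> {cl a}) u" for u
    unfolding mix_def
  proof
    fix Q
    have "meas F (\<lambda>b. cl b \<in> Q) u \<longleftrightarrow> cl a \<in> Q"
    proof
      assume "cl a \<in> Q"
      then show "meas F (\<lambda>b. cl b \<in> Q) u" by (intro meas_mono[OF u(2)]) auto
    next
      assume m: "meas F (\<lambda>b. cl b \<in> Q) u"
      show "cl a \<in> Q"
      proof (rule ccontr)
        assume "cl a \<notin> Q"
        then have "meas F (\<lambda>b. \<not> cl b \<in> Q) u" by (intro meas_mono[OF u(2)]) auto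
        then show False using m meas_not[OF front u(1), of "\<lambda>b. cl b \<in> Q"] by simp
      qed
    qed
    then show "meas F (\<lambda>a. cl a \<in> Q) a \<longleftrightarrow> meas F (\<lambda>a. cl a \<in> Q) u"
      using assms(1) by (simp add: meas_leaf)
  qed
  have "meas F (\<lambda>b. cl b \<in> {cl a}) a" using assms(1) by (simp add: meas_leaf)
  then have "meas F (\<lambda>b. cl b \<in> {cl a}) t" using assms(4) unfolding mix_def by blast
  then have "eventually (\<lambda>n. meas F (\<lambda>b. cl b \<in> {cl a}) (t @ [n])) (U (qn t))"
    by (simp add: meas_node[OF assms(3)])
  then have "eventually (\<lambda>n. mix t (t @ [n])) (U (qn t))"
    using eventually_tr[OF assms(2,3), of 0]
  proof eventually_elim
    case (elim n)
    then have "mix a (t @ [n])" using point by blast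
    then show ?case using assms(4) mix_trans mix_sym by blast
  qed
  then show ?thesis by (simp add: recd_def)
qed

lemma ext_0:
  assumes "T a" "set a \<subseteq> S" shows "ext 0 S [0] a"
proof -
  obtain z where a: "a = 0 # z"
    using tr_valid[OF assms(1)] by (cases a) (auto simp: valid_def)
  have "0 < x" if "x \<in> set z" for x
    using tr_valid[OF assms(1)] that by (auto simp: a valid_def)
  then show ?thesis using assms tr_0[OF front] by (auto simp: ext_def a)
qed

text \<open>Tracing gives one direction. Conversely, unrecorded last nodes are stripped; two
  recorded last nodes are the maxima of the same set, hence equal, and the shorter lists mix by
  induction. By \<open>recd_sync\<close> almost all common prolongations mix, and by genericity the
  given one does.\<close>

lemma mix_iff_D:
  assumes g: "gen 0 S" and "T a" "T b" "set a \<subseteq> S" "set b \<subseteq> S"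
  shows "mix a b \<longleftrightarrow> D a = D b"
proof
  assume "mix a b"
  then have "D a \<inter> {0<..} = D b \<inter> {0<..}" using trace_D[OF g ext_0 ext_0] assms by blast
  then show "D a = D b" using D_pos assms(2,3) by (auto simp: set_eq_iff)
next
  show "D a = D b \<Longrightarrow> mix a b" using assms(2-5)
  proof (induction "length a + length b" arbitrary: a b rule: less_induct)
    case less
    note ea = ext_0[OF less.prems(2,4)] and eb = ext_0[OF less.prems(3,5)]
    have strip: "\<exists>b' y. b = b' @ [y] \<and> b' \<noteq> [] \<and> T b' \<and> b' \<notin> F \<and> set b' \<subseteq> S \<inter> {..<y} \<and>
        D b = D b' \<union> (if recd b' then {y} else {}) \<and> b' @ [y] \<noteq> [0] \<and> (\<not> recd b' \<longrightarrow> mix b' b)"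
      if e: "ext 0 S [0] b" and nb: "b \<noteq> [0]" for b
    proof -
      obtain b' y where b: "b = b' @ [y]"
        using T_ne[of b] e by (cases b rule: rev_cases) (auto simp: ext_def)
      note ne = nb[unfolded b]
      show ?thesis
        using ext_snocD[OF g e[unfolded b] ne] gen_rules(1)[OF g e[unfolded b] ne] ne
        by (intro exI[of _ b'] exI[of _ y]) (simp add: b D_snoc)
    qed
    have a_step: "mix a b" if "a = a' @ [x]" "T a'" "set a' \<subseteq> S" "D a = D a'" "mix a' a" for a' x
    proof -
      have "mix a' b" using less.hyps[of a' b] less.prems that by auto
      then show ?thesis using that(5) mix_trans mix_sym by blast
    qed
    show ?case
    proof (cases "b = [0]")
      case b0: True
      show ?thesis
      proof (cases "a = [0]")
        case False
        obtain a' x where a: "a = a' @ [x]" "T a'" "set a' \<subseteq> S \<inter> {..<x}"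
          "D a = D a' \<union> (if recd a' then {x} else {})" "\<not> recd a' \<longrightarrow> mix a' a"
          using strip[OF ea False] by blast
        have "\<not> recd a'" using a(4) less.prems(1) b0 by auto
        then show ?thesis using a by (intro a_step[of a' x]) auto
      qed (simp add: b0)
    next
      case bn: False
      obtain b' y where b: "b = b' @ [y]" "b' \<noteq> []" "T b'" "b' \<notin> F" "set b' \<subseteq> S \<inter> {..<y}"
        "D b = D b' \<union> (if recd b' then {y} else {})" "\<not> recd b' \<longrightarrow> mix b' b"
        using strip[OF eb bn] by blast
      show ?thesis
      proof (cases "recd b'")
        case False
        then have "mix a b'" using less.hyps[of a b'] less.prems b by auto
        then show ?thesis using b(7) False mix_trans by blast
      next
        case rb: True
        then have an: "a \<noteq> [0]" using b(6) less.prems(1) by auto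
        obtain a' x where a: "a = a' @ [x]" "a' \<noteq> []" "T a'" "a' \<notin> F" "set a' \<subseteq> S \<inter> {..<x}"
          "D a = D a' \<union> (if recd a' then {x} else {})" "\<not> recd a' \<longrightarrow> mix a' a" "a' @ [x] \<noteq> [0]"
          using strip[OF ea an] by blast
        show ?thesis
        proof (cases "recd a'")
          case False
          then show ?thesis using a by (intro a_step[of a' x]) auto
        next
          case ra: True
          have eq: "insert x (D a') = insert y (D b')" using less.prems(1) a(6) b(6) ra rb by simp
          have lx: "u < x" if "u \<in> D a'" for u using that D_subset[of a'] a(5) by auto
          have ly: "u < y" if "u \<in> D b'" for u using that D_subset[of b'] b(5) by auto
          have "x \<in> insert y (D b')" "y \<in> insert x (D a')" using eq by auto
          then have xy: "x = y" using lx ly by force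
          have "x \<notin> D a'" "x \<notin> D b'" using lx ly xy by auto
          then have DD: "D a' = D b'" using eq xy by (simp add: insert_ident)
          have "length a' + length b' < length a + length b" by (simp add: a b)
          moreover have "set a' \<subseteq> S" "set b' \<subseteq> S" using a(5) b(5) by auto
          ultimately have "mix a' b'" using less.hyps[of a' b'] DD a(3) b(3) by blast
          then have "eventually (\<lambda>n. mix (a' @ [n]) (b' @ [n])) (U (qn a'))"
            using recd_sync(2) a(3) b(3) ra rb by blast
          moreover have "set b' \<subseteq> S \<inter> {..<x}" using b(5) xy by simp
          ultimately show ?thesis
            using gen_rules(3)[OF g ea[unfolded a(1)] a(8), of b'] b(3) by (simp add: a(1) b(1) xy)
        qed
      qed
    qed
  qed
qed

text \<open>For an unrecorded parent, \<open>unrecorded_no_child\<close> predicts that it gets no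
  recorded child. Genericity keeps the prediction along \<open>a\<close>, and at the front it
  becomes a fact, contradicting \<open>y\<close>.\<close>

lemma D_par_closed:
  assumes g: "gen 0 S" and a: "a \<in> F" "set a \<subseteq> S" and y: "y \<in> D a"
  shows "par y = 0 \<or> par y \<in> D a"
proof (rule ccontr)
  assume neg: "\<not> ?thesis"
  let ?x = "par y"
  note Ta = front_tr[OF front a(1)]
  have "?x \<in> set a" using y D_subset valid_par_closed[OF tr_valid[OF Ta]] by blast
  then obtain c z where cz: "a = c @ ?x # z" by (meson split_list)
  then have p: "prefix (c @ [?x]) a" by (auto simp: prefix_def)
  have c: "c \<noteq> []" using cz neg tr_valid[OF Ta] by (auto simp: valid_def)
  then have nr: "\<not> recd c" using neg p by (auto simp: D_def)
  have T: "T (c @ [?x])" "T c" using tr_prefix[OF Ta p] c by (auto simp: tr_snoc)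
  have F: "c \<notin> F" using T c by (simp add: tr_snoc)
  have e: "ext 0 S [0] (c @ [?x])" by (rule ext_0[OF T(1)]) (use a(2) cz in auto)
  have ne: "c @ [?x] \<noteq> [0]" using c by simp
  have nm: "\<not> meas F (has_child ?x) (c @ [?x])"
    by (rule unrecorded_no_child[OF T(2) F nr T(1) gen_rules(1)[OF g e ne nr]])
  have "\<not> meas F (has_child ?x) b" if "prefix (c @ [?x]) b" "prefix b a" for b
    using that
  proof (induction b rule: rev_induct)
    case (snoc n b)
    show ?case
    proof (cases "c @ [?x] = b @ [n]")
      case False
      then have pb: "prefix (c @ [?x]) b" using snoc.prems(1) by (simp only: prefix_snoc) blast
      have Tb: "T (b @ [n])" using tr_prefix[OF Ta snoc.prems(2)] by simp
      have eb: "ext 0 S [0] (b @ [n])"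
        by (rule ext_0[OF Tb]) (use a(2) snoc.prems(2) in \<open>auto simp: prefix_def\<close>)
      have nb: "b @ [n] \<noteq> [0]" using pb by auto
      have "?x \<in> S" "?x < n"
        using ext_snocD(8)[OF g eb nb] pb by (auto simp: prefix_def)
      then show ?thesis
        using gen_rules(4)[OF g eb nb] snoc.IH[OF pb] snoc.prems(2) by (auto simp: prefix_def)
    qed (use nm in simp)
  qed simp
  from this[OF p] have "\<not> has_child ?x a" using meas_leaf[OF a(1)] by simp
  then show False using y by (auto simp: has_child_def)
qed

end

section \<open>Canonization of fronts of node lists\<close>

context decided_front
begin

lemma homogeneous_below:
  assumes B: "emb B"
  shows "\<exists>B'. emb B' \<and> range B' \<subseteq> range B \<and>
    ((\<forall>a\<in>F. set a \<subseteq> range B' \<longrightarrow> P a) \<or> (\<forall>a\<in>F. set a \<subseteq> range B' \<longrightarrow> \<not> P a))"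
proof -
  obtain h where h: "emb h"
    "(\<forall>a\<in>pull B F. set a \<subseteq> range h \<longrightarrow> P (map B a)) \<or>
     (\<forall>a\<in>pull B F. set a \<subseteq> range h \<longrightarrow> \<not> P (map B a))"
    using homogeneous[OF node_front_pull[OF front B], of "\<lambda>a. P (map B a)"] by blast
  note e = emb_comp[OF B h(1)]
  have *: "\<exists>t\<in>pull B F. set t \<subseteq> range h \<and> a = map B t"
    if a: "a \<in> F" "set a \<subseteq> range (\<lambda>x. B (h x))" for a
  proof -
    obtain t where t: "valid t" "a = map (\<lambda>x. B (h x)) t"
      using valid_range_map[OF e front_valid[OF front a(1)] a(2)] by blast
    then show ?thesis
      using a(1) valid_map[OF h(1), of t] by (intro bexI[of _ "map h t"]) (auto simp: pull_def comp_def)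
  qed
  let ?g = "\<lambda>x. B (h x)"
  have "(\<forall>a\<in>F. set a \<subseteq> range ?g \<longrightarrow> P a) \<or> (\<forall>a\<in>F. set a \<subseteq> range ?g \<longrightarrow> \<not> P a)"
    using h(2)
  proof
    assume P: "\<forall>a\<in>pull B F. set a \<subseteq> range h \<longrightarrow> P (map B a)"
    have "P a" if "a \<in> F" "set a \<subseteq> range ?g" for a
      using *[OF that] P by auto
    then show ?thesis by blast
  next
    assume P: "\<forall>a\<in>pull B F. set a \<subseteq> range h \<longrightarrow> \<not> P (map B a)"
    have "\<not> P a" if "a \<in> F" "set a \<subseteq> range ?g" for a
      using *[OF that] P by auto
    then show ?thesis by blast
  qed
  moreover have "range ?g \<subseteq> range B" by auto
  ultimately show ?thesis using e by (intro exI[of _ ?g] conjI)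
qed

text \<open>As long as the next node would not be recorded, any node of the subtree can be appended;
  bar induction shows that this stops.\<close>

lemma fill:
  assumes B: "emb B" and s: "T s" "set s \<subseteq> range B"
  shows "\<exists>d. T d \<and> set d \<subseteq> range B \<and> D d = D s \<and> (d \<in> F \<or> recd d)"
  using front s
proof (induction rule: bar_induct)
  case (leaf s)
  then have "T s" using front_tr[OF front] by blast
  with leaf show ?case by blast
next
  case (node s)
  show ?case
  proof (cases "recd s")
    case True
    with node show ?thesis by blast
  next
    case False
    obtain s' where s': "valid s'" "s = map B s'"
      using valid_range_map[OF B tr_valid[OF node.hyps(1)] node.prems] by blast
    obtain n where n: "last s' < n" "par n = qn s'"
      using U_ex[OF lvl_qn[OF s'(1)] U_gt[OF lvl_qn[OF s'(1)]]] by blast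
    have "valid (map B (s' @ [n]))"
      using valid_map[OF B, of "s' @ [n]"] valid_snoc[OF s'(1)] n by simp
    then have v: "valid (s @ [B n])" by (simp add: s'(2))
    then have Tn: "T (s @ [B n])"
      using node.hyps T_ne valid_snoc[OF tr_valid[OF node.hyps(1)]] by (simp add: tr_snoc)
    obtain d where d: "T d" "set d \<subseteq> range B" "D d = D (s @ [B n])" "d \<in> F \<or> recd d"
      using node.IH[OF Tn] node.prems by auto
    moreover have "D (s @ [B n]) = D s" using False T_ne[OF node.hyps(1)] by (simp add: D_snoc)
    ultimately show ?thesis by auto
  qed
qed

text \<open>Only finitely many lists live on the nodes up to \<open>n\<close>, so one bound serves
  all their fillings. It measures the room needed between recorded nodes when a front element is
  rebuilt.\<close>

lemma fill_bound:
  assumes B: "emb B"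
  obtains K where "\<And>s n. T s \<Longrightarrow> set s \<subseteq> range B \<inter> {..n} \<Longrightarrow>
    \<exists>d. T d \<and> set d \<subseteq> range B \<inter> {..K n} \<and> D d = D s \<and> (d \<in> F \<or> recd d)"
proof -
  define f where "f s = (SOME d. T d \<and> set d \<subseteq> range B \<and> D d = D s \<and> (d \<in> F \<or> recd d))" for s
  have f: "T (f s) \<and> set (f s) \<subseteq> range B \<and> D (f s) = D s \<and> (f s \<in> F \<or> recd (f s))"
    if "T s" "set s \<subseteq> range B" for s
    unfolding f_def by (rule someI_ex[OF fill[OF B that]])
  define A where "A n = {s. set s \<subseteq> {..n} \<and> T s}" for n
  have fin: "finite (\<Union>s\<in>A n. set (f s))" for n
    using finite_trs[of "{..n}" F] by (simp add: A_def)
  show ?thesis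
  proof (rule that[of "\<lambda>n. Max (\<Union>s\<in>A n. set (f s))"])
    fix s n assume s: "T s" "set s \<subseteq> range B \<inter> {..n}"
    then have "s \<in> A n" by (auto simp: A_def)
    then have "set (f s) \<subseteq> {..Max (\<Union>s\<in>A n. set (f s))}"
      using Max_ge[OF fin[of n]] by auto
    then show "\<exists>d. T d \<and> set d \<subseteq> range B \<inter> {..Max (\<Union>s\<in>A n. set (f s))} \<and> D d = D s \<and>
        (d \<in> F \<or> recd d)"
      using f[of s] s by (intro exI[of _ "f s"]) auto
  qed
qed

text \<open>An element of the front can be rebuilt from its recorded nodes alone, with fresh unrecorded
  nodes, provided there is enough room between the recorded ones.\<close>
lemma rebuild:
  assumes g: "gen 0 S" and B: "emb B" "range B \<subseteq> S"
    and K: "\<And>s n. T s \<Longrightarrow> set s \<subseteq> range B \<inter> {..n} \<Longrightarrow>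
      \<exists>d. T d \<and> set d \<subseteq> range B \<inter> {..K n} \<and> D d = D s \<and> (d \<in> F \<or> recd d)"
    and Z: "0 \<in> Z" "Z \<subseteq> range B" "\<And>u w. u \<in> Z \<Longrightarrow> w \<in> Z \<Longrightarrow> u < w \<Longrightarrow> K u < w"
    and a: "a \<in> F" "set a \<subseteq> S" "D a \<subseteq> Z"
  shows "\<exists>a'\<in>F. set a' \<subseteq> range B \<and> D a' = D a"
proof -
  note Ta = front_tr[OF front a(1)]
  \<comment> \<open>The bound \<open>u\<close> is 0 or a recorded node of \<open>s\<close>, so the
    gaps in \<open>Z\<close> let the filling of \<open>d\<close> end before the next recorded
    node.\<close>
  have "\<exists>d u. T d \<and> set d \<subseteq> range B \<inter> {..u} \<and> D d = D s \<and> u \<in> Z \<and> (u = 0 \<or> u \<in> D s)"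
    if "s \<noteq> []" "prefix s a" for s
    using that
  proof (induction s rule: rev_induct)
    case (snoc n s)
    note Ts = tr_prefix[OF Ta snoc.prems(2,1)]
    show ?case
    proof (cases "s = []")
      case True
      have "n = 0" using tr_valid[OF Ts] True by (simp add: valid_def)
      then show ?thesis
        using tr_0[OF front] Z True by (intro exI[of _ "[0]"] exI[of _ 0]) auto
    next
      case ne: False
      obtain d u where d: "T d" "set d \<subseteq> range B \<inter> {..u}" "D d = D s" "u \<in> Z" "u = 0 \<or> u \<in> D s"
        using snoc.IH[OF ne append_prefixD[OF snoc.prems(2)]] by blast
      show ?thesis
      proof (cases "recd s")
        case False
        then show ?thesis using d ne by (intro exI[of _ d] exI[of _ u]) (auto simp: D_snoc)
      next
        case True
        have s: "T s" "s \<notin> F" "last s < n" "par n = qn s" using Ts ne by (auto simp: tr_snoc)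
        have "n \<in> D a" using True ne snoc.prems(2) by (auto simp: D_def)
        then have nZ: "n \<in> Z" using a(3) by blast
        have "u < n"
          using d(5) D_subset[of s] valid_le_last[OF tr_valid[OF s(1)], of u] s(3) by auto
        then have Kn: "K u < n" using Z(3) d(4) nZ by blast
        obtain d' where d': "T d'" "set d' \<subseteq> range B \<inter> {..K u}" "D d' = D d" "d' \<in> F \<or> recd d'"
          using K[OF d(1,2)] by blast
        have ss: "set s \<subseteq> S" using snoc.prems(2) a(2) by (auto simp: prefix_def)
        have m: "mix d' s"
          using mix_iff_D[OF g d'(1) s(1) _ ss] d'(2,3) d(3) B(2) by auto
        have "d' \<notin> F" using mix_leaf[OF _ s(1,2) m] True by blast
        then have r: "recd d'" using d'(4) by blast
        \<comment> \<open>Two mixed lists at recorded positions demand the same parent, so the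
          original node \<open>n\<close> fits after \<open>d'\<close> as well.\<close>
        have q: "qn d' = qn s" by (rule recd_sync(1)[OF d'(1) s(1) r True m])
        have ne': "d' \<noteq> []" by (rule T_ne[OF d'(1)])
        then have "last d' \<in> set d'" by simp
        then have "last d' < n" using d'(2) Kn by auto
        then have "T (d' @ [n])"
          using d'(1) \<open>d' \<notin> F\<close> q s(4) ne' by (simp add: tr_snoc)
        moreover have "set (d' @ [n]) \<subseteq> range B \<inter> {..n}" using d'(2) Kn nZ Z(2) by auto
        moreover have "D (d' @ [n]) = D (s @ [n])" using r True ne ne' d'(3) d(3) by (simp add: D_snoc)
        moreover have "n \<in> D (s @ [n])" using True ne by (simp add: D_snoc)
        ultimately show ?thesis using nZ by blast
      qed
    qed
  qed simp
  from this[OF T_ne[OF Ta] prefix_order.refl] obtain d u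
    where d: "T d" "set d \<subseteq> range B \<inter> {..u}" "D d = D a" by blast
  obtain d' where d': "T d'" "set d' \<subseteq> range B \<inter> {..K u}" "D d' = D d" "d' \<in> F \<or> recd d'"
    using K[OF d(1,2)] by blast
  have "mix a d'" using mix_iff_D[OF g Ta d'(1) a(2)] d'(2,3) d(3) B(2) by auto
  then have "d' \<in> F" using mix_leaf[OF a(1) d'(1)] d'(4) by blast
  with d' d show ?thesis by auto
qed

text \<open>Otherwise every \<open>b\<close> over \<open>range B\<close> admits an \<open>a\<close>
  with smaller \<open>D a\<close>, but only over \<open>S\<close>. If the recorded nodes lie in a
  subtree \<open>Z\<close> of \<open>range B\<close> with gaps given by \<open>K\<close>, rebuilding
  moves \<open>a\<close> into \<open>range B\<close> without changing them, and the step can be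
  repeated: an infinite descent of finite sets.\<close>

lemma no_descent:
  assumes g: "gen 0 S" and B: "emb B" "range B \<subseteq> S"
  shows "\<exists>b\<in>F. set b \<subseteq> range B \<and> \<not> (\<exists>a\<in>F. set a \<subseteq> S \<and> D a \<subset> D b)"
proof (rule ccontr)
  assume "\<not> ?thesis"
  then have bad: "\<exists>a\<in>F. set a \<subseteq> S \<and> D a \<subset> D b" if "b \<in> F" "set b \<subseteq> range B" for b
    using that by blast
  obtain K where K: "\<And>s n. T s \<Longrightarrow> set s \<subseteq> range B \<inter> {..n} \<Longrightarrow>
    \<exists>d. T d \<and> set d \<subseteq> range B \<inter> {..K n} \<and> D d = D s \<and> (d \<in> F \<or> recd d)"
    using fill_bound[OF B(1)] by blast
  have ev: "eventually (\<lambda>n. \<forall>v\<in>V. K (B v) < n) (U q)" if V: "finite V" and q: "lvl q < k" for V q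
  proof (rule eventually_ball_finite[OF V], rule ballI)
    fix v assume "v \<in> V"
    show "eventually (\<lambda>n. K (B v) < n) (U q)"
      using U_gt[OF q, of "K (B v)"] by eventually_elim simp
  qed
  obtain h where h: "emb h" "\<forall>n\<in>range h. 0 < n \<longrightarrow> (\<forall>v\<in>range h \<inter> {..<n}. K (B v) < n)"
    using fusion[of "\<lambda>V n. \<forall>v\<in>V. K (B v) < n" 0, OF ev] by auto
  define Z where "Z = range (\<lambda>x. B (h x))"
  have e: "emb (\<lambda>x. B (h x))" by (rule emb_comp[OF B(1) h(1)])
  have Z: "0 \<in> Z" "Z \<subseteq> range B" using e by (auto simp: Z_def emb_def intro: range_eqI[of _ _ 0])
  have gap: "K u < w" if uw: "u \<in> Z" "w \<in> Z" "u < w" for u w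
  proof -
    obtain x y where xy: "u = B (h x)" "w = B (h y)" using uw by (auto simp: Z_def)
    then have "h x < h y" using uw(3) emb_less_iff[OF B(1)] by simp
    \<comment> \<open>The fusion bounds \<open>K (B v)\<close> by the node before \<open>B\<close>
      is applied; this suffices since \<open>B\<close> never decreases a node.\<close>
    then have "K u < h y" using h(2) xy(1) by auto
    also have "\<dots> \<le> w" using emb_ge[OF B(1)] xy(2) by simp
    finally show ?thesis .
  qed
  have no: "\<not> (b \<in> F \<and> set b \<subseteq> range B \<and> D b \<subseteq> Z)" for b
  proof (induction "card (D b)" arbitrary: b rule: less_induct)
    case less
    show ?case
    proof
      assume b: "b \<in> F \<and> set b \<subseteq> range B \<and> D b \<subseteq> Z"
      then obtain a where a: "a \<in> F" "set a \<subseteq> S" "D a \<subset> D b" using bad by blast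
      have "D a \<subseteq> Z" using a(3) b by blast
      then have "\<exists>a'\<in>F. set a' \<subseteq> range B \<and> D a' = D a"
        by (intro rebuild[where K = K, OF g B _ Z _ a(1,2)]) (erule (1) K, erule (2) gap)
      then obtain a' where a': "a' \<in> F" "set a' \<subseteq> range B" "D a' = D a" by blast
      have "card (D a') < card (D b)"
        using a(3) a'(3) finite_subset[OF D_subset, of b] by (simp add: psubset_card_mono)
      then show False using less[of a'] a' a(3) b by blast
    qed
  qed
  obtain n where n: "map (\<lambda>x. B (h x)) [0..<Suc n] \<in> F" using front e by (auto simp: node_front_def)
  have "set (map (\<lambda>x. B (h x)) [0..<Suc n]) \<subseteq> Z" by (auto simp: Z_def)
  then show False using no[of "map (\<lambda>x. B (h x)) [0..<Suc n]"] n Z(2) D_subset by blast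
qed

lemma canonical:
  "\<exists>g. emb g \<and>
    (\<forall>a\<in>F. set a \<subseteq> range g \<longrightarrow> (\<forall>y\<in>D a. par y = 0 \<or> par y \<in> D a)) \<and>
    (\<forall>a\<in>F. \<forall>b\<in>F. set a \<subseteq> range g \<longrightarrow> set b \<subseteq> range g \<longrightarrow>
      (cl a = cl b \<longleftrightarrow> D a = D b) \<and> (D a \<subseteq> D b \<longrightarrow> D a = D b)) \<and>
    ((\<forall>a\<in>F. set a \<subseteq> range g \<longrightarrow> P a) \<or> (\<forall>a\<in>F. set a \<subseteq> range g \<longrightarrow> \<not> P a))"
proof -
  obtain B where B: "emb B" "gen 0 (range B)" using gen_exists[of 0] by blast
  \<comment> \<open>The smaller set is sought over \<open>range B\<close>, not over later subtrees.
    So badness is a fixed property of single front elements that can be homogenized, and its absence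
    persists under thinning.\<close>
  define bad where "bad b \<longleftrightarrow> (\<exists>a\<in>F. set a \<subseteq> range B \<and> D a \<subset> D b)" for b
  obtain B1 where B1: "emb B1" "range B1 \<subseteq> range B"
    "(\<forall>a\<in>F. set a \<subseteq> range B1 \<longrightarrow> bad a) \<or> (\<forall>a\<in>F. set a \<subseteq> range B1 \<longrightarrow> \<not> bad a)"
    using homogeneous_below[OF B(1), of bad] by blast
  have "\<exists>b\<in>F. set b \<subseteq> range B1 \<and> \<not> bad b"
    using no_descent[OF B(2) B1(1,2)] by (simp add: bad_def)
  then have nb: "\<not> bad a" if "a \<in> F" "set a \<subseteq> range B1" for a
    using B1(3) that by blast
  define homog where "homog R \<longleftrightarrow> (\<forall>a\<in>F. set a \<subseteq> R \<longrightarrow> P a) \<or> (\<forall>a\<in>F. set a \<subseteq> R \<longrightarrow> \<not> P a)" for R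
  have "\<exists>B2. emb B2 \<and> range B2 \<subseteq> range B1 \<and> homog (range B2)"
    unfolding homog_def by (rule homogeneous_below[OF B1(1)])
  then obtain B2 where B2: "emb B2" "range B2 \<subseteq> range B1" "homog (range B2)" by blast
  show ?thesis
  proof (intro exI[of _ B2] conjI ballI impI)
    fix a y assume a: "a \<in> F" "set a \<subseteq> range B2" "y \<in> D a"
    then have "set a \<subseteq> range B" using B1(2) B2(2) by auto
    then show "par y = 0 \<or> par y \<in> D a" using D_par_closed[OF B(2)] a by simp
  next
    fix a b assume ab: "a \<in> F" "b \<in> F" "set a \<subseteq> range B2" "set b \<subseteq> range B2"
    then have sub: "set a \<subseteq> range B" "set b \<subseteq> range B" using B1(2) B2(2) by auto
    show "cl a = cl b \<longleftrightarrow> D a = D b"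
      using mix_iff_D[OF B(2) front_tr[OF front ab(1)] front_tr[OF front ab(2)] sub]
        mix_front[OF ab(1,2)] by simp
    show "D a = D b" if "D a \<subseteq> D b"
    proof -
      have "\<not> bad b" using nb[OF ab(2)] ab(4) B2(2) by auto
      then have "\<not> D a \<subset> D b" using ab(1) sub(1) by (auto simp: bad_def)
      then show ?thesis using that by auto
    qed
  qed (use B2 in \<open>simp_all add: homog_def\<close>)
qed

end

context node_tree
begin

text \<open>There are two embeddings because recording refers to the ultrafilters on the decided
  front \<open>pull G F\<close>; the generic subtree \<open>range g\<close> is kept as a set of
  nodes instead of changing coordinates again.\<close>

theorem front_canonization:
  fixes cl :: "nat list \<Rightarrow> 'c"
  assumes F: "node_front F"
  shows "\<exists>G g D. emb G \<and> emb g \<and>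
    (\<forall>a\<in>pull G F. set a \<subseteq> range g \<longrightarrow> D a \<subseteq> set a - {0} \<and> (\<forall>y\<in>D a. par y = 0 \<or> par y \<in> D a)) \<and>
    (\<forall>a\<in>pull G F. \<forall>b\<in>pull G F. set a \<subseteq> range g \<longrightarrow> set b \<subseteq> range g \<longrightarrow>
      (cl (map G a) = cl (map G b) \<longleftrightarrow> D a = D b) \<and> (D a \<subseteq> D b \<longrightarrow> D a = D b)) \<and>
    ((\<forall>a\<in>pull G F. set a \<subseteq> range g \<longrightarrow> P a (D a)) \<or> (\<forall>a\<in>pull G F. set a \<subseteq> range g \<longrightarrow> \<not> P a (D a)))"
proof -
  obtain G where G: "emb G" "decided (pull G F) (\<lambda>a. cl (map G a))" using decided_exists by blast
  interpret decided_front par lvl k "pull G F" "\<lambda>a. cl (map G a)"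
    by unfold_locales (use node_front_pull[OF F G(1)] G(2) in auto)
  have D: "D a \<subseteq> set a - {0}" if "a \<in> pull G F" for a
    using D_subset D_pos[OF front_tr[OF front that]] by blast
  show ?thesis
    using canonical[of "\<lambda>a. P a (D a)"]
  proof (elim exE conjE)
    fix g
    assume g: "emb g"
      and closed: "\<forall>a\<in>pull G F. set a \<subseteq> range g \<longrightarrow> (\<forall>y\<in>D a. par y = 0 \<or> par y \<in> D a)"
      and canon: "\<forall>a\<in>pull G F. \<forall>b\<in>pull G F. set a \<subseteq> range g \<longrightarrow> set b \<subseteq> range g \<longrightarrow>
        (cl (map G a) = cl (map G b) \<longleftrightarrow> D a = D b) \<and> (D a \<subseteq> D b \<longrightarrow> D a = D b)"
      and homog: "(\<forall>a\<in>pull G F. set a \<subseteq> range g \<longrightarrow> P a (D a)) \<or>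
        (\<forall>a\<in>pull G F. set a \<subseteq> range g \<longrightarrow> \<not> P a (D a))"
    have "\<forall>a\<in>pull G F. set a \<subseteq> range g \<longrightarrow>
        D a \<subseteq> set a - {0} \<and> (\<forall>y\<in>D a. par y = 0 \<or> par y \<in> D a)"
      using closed D by blast
    with G(1) g canon homog show ?thesis
      by (intro exI[of _ G] exI[of _ g] exI[of _ D] conjI)
  qed
qed

end

section \<open>Paths\<close>

context node_tree
begin

text \<open>The root is left out to match \<open>W\<close>, which uses nonempty prefixes only; hence
  a path has as many members as the level of its end.\<close>

definition path :: "nat \<Rightarrow> nat set" where
  "path n = {x. 0 < x \<and> (\<exists>i. x = (par ^^ i) n)}"

lemma node_induct[case_names zero step]:
  assumes "P 0" "\<And>n. 0 < n \<Longrightarrow> P (par n) \<Longrightarrow> P n"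
  shows "P n"
proof (induction n rule: less_induct)
  case (less n)
  then show ?case using assms par_less[of n] by (cases "n = 0") auto
qed

lemma path_0[simp]: "path 0 = {}"
proof -
  have "(par ^^ i) 0 = 0" for i by (induction i) (auto simp: par_0)
  then show ?thesis unfolding path_def by auto
qed

lemma path_step:
  assumes "0 < n" shows "path n = insert n (path (par n))"
proof -
  have "(\<exists>i. x = (par ^^ i) n) \<longleftrightarrow> x = n \<or> (\<exists>i. x = (par ^^ i) (par n))" for x
  proof
    assume "\<exists>i. x = (par ^^ i) n"
    then obtain i where i: "x = (par ^^ i) n" ..
    show "x = n \<or> (\<exists>i. x = (par ^^ i) (par n))"
    proof (cases i)
      case (Suc j)
      then have "x = (par ^^ j) (par n)" using i by (simp add: funpow_swap1)
      then show ?thesis by blast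
    qed (use i in simp)
  next
    assume "x = n \<or> (\<exists>i. x = (par ^^ i) (par n))"
    then show "\<exists>i. x = (par ^^ i) n"
    proof
      assume "x = n"
      then show ?thesis by (intro exI[of _ 0]) simp
    next
      assume "\<exists>i. x = (par ^^ i) (par n)"
      then obtain i where "x = (par ^^ i) (par n)" ..
      then show ?thesis by (intro exI[of _ "Suc i"]) (simp add: funpow_swap1)
    qed
  qed
  then show ?thesis using assms by (auto simp: path_def)
qed

lemma path_le: "x \<in> path n \<Longrightarrow> 0 < x \<and> x \<le> n"
proof (induction n rule: node_induct)
  case (step n)
  then show ?case using par_less[OF step(1)] by (auto simp: path_step)
qed simp

lemma finite_path: "finite (path n)"
  by (rule finite_subset[of _ "{..n}"]) (use path_le in auto)

lemma card_path: "card (path n) = lvl n"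
proof (induction n rule: node_induct)
  case (step n)
  have "n \<notin> path (par n)" using path_le[of n "par n"] par_less[OF step(1)] by auto
  with step show ?case by (simp add: path_step finite_path lvl_par)
qed (simp add: lvl_0)

lemma self_path: "0 < n \<Longrightarrow> n \<in> path n"
  by (simp add: path_step)

lemma Max_path: "0 < n \<Longrightarrow> Max (path n) = n"
  by (rule Max_eqI) (use finite_path path_le self_path in auto)

lemma path_inj: "path m = path n \<longleftrightarrow> m = n"
proof
  assume eq: "path m = path n"
  then show "m = n"
    using self_path[of m] self_path[of n] path_le[of m n] path_le[of n m] by (cases "m = 0"; cases "n = 0") auto
qed simp

lemma path_emb: "emb g \<Longrightarrow> path (g n) = g ` path n"
proof (induction n rule: node_induct)
  case zero
  then show ?case by (simp add: emb_def)
next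
  case (step n)
  have "0 < g n" using emb_ge[OF step(3), of n] step(1) by simp
  with step show ?case by (simp add: path_step emb_def)
qed

lemma path_valid: "valid s \<Longrightarrow> n < length s \<Longrightarrow> path (s ! n) = (!) s ` path n"
proof (induction n rule: node_induct)
  case zero
  then show ?case by (simp add: valid_def)
next
  case (step n)
  have "0 < s ! n" using valid_less[OF step(3), of 0 n] step(1,4) by simp
  moreover have "par (s ! n) = s ! par n" using step(3,4) by (simp add: valid_def)
  ultimately show ?case using step par_le[of n] by (simp add: path_step)
qed

lemma path_restrict: "v \<in> path n \<Longrightarrow> path v = path n \<inter> {..v}"
proof (induction n rule: node_induct)
  case (step n)
  show ?case
  proof (cases "v = n")
    case True
    then show ?thesis using path_le by auto
  next
    case False
    then have v: "v \<in> path (par n)" using step by (simp add: path_step)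
    then have "v < n" using path_le[OF v] par_less[OF step(1)] by simp
    then show ?thesis using step(2)[OF v] by (auto simp: path_step[OF step(1)])
  qed
qed simp

lemma path_lvl_le: "v \<in> path n \<Longrightarrow> lvl v \<le> lvl n"
proof -
  assume "v \<in> path n"
  then have "path v \<subseteq> path n" using path_restrict[of v n] by blast
  then have "card (path v) \<le> card (path n)" by (rule card_mono[OF finite_path])
  then show ?thesis by (simp add: card_path)
qed

lemma path_lvl_par:
  assumes "v \<in> path n" "Suc (lvl v) = lvl n" shows "v = par n"
proof -
  have n: "0 < n" using path_le[OF assms(1)] by simp
  have "v \<noteq> n" using assms by auto
  then have v: "v \<in> path (par n)" using assms(1) by (simp add: path_step[OF n])
  have "lvl v = lvl (par n)" using assms(2) lvl_par[OF n] by simp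
  moreover have "path v \<subseteq> path (par n)" using path_restrict[OF v] by blast
  ultimately have "path v = path (par n)"
    by (intro card_seteq finite_path) (simp_all add: card_path)
  then show ?thesis by (simp add: path_inj)
qed

lemma path_child:
  "v \<in> path n \<Longrightarrow> v \<noteq> n \<Longrightarrow> \<exists>y\<in>path n. par y = v"
proof (induction n rule: node_induct)
  case (step n)
  then have "v \<in> path (par n)" by (simp add: path_step)
  then show ?case using step by (cases "v = par n") (auto simp: path_step[OF step(1)])
qed simp

lemma sorted_list_path:
  "0 < n \<Longrightarrow> sorted_list_of_set (path n) = sorted_list_of_set (path (par n)) @ [n]"
proof -
  assume n: "0 < n"
  have less: "x < n" if "x \<in> path (par n)" for x using path_le[OF that] par_less[OF n] by simp
  then have "n \<notin> path (par n)" by auto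
  then have "sorted_list_of_set (path n) = insort n (sorted_list_of_set (path (par n)))"
    by (simp add: path_step[OF n] finite_path sorted_list_of_set.sorted_key_list_of_set_insert)
  also have "\<dots> = sorted_list_of_set (path (par n)) @ [n]"
    by (rule sorted_insort_is_snoc) (use less in \<open>auto simp: finite_path intro: less_imp_le\<close>)
  finally show ?thesis .
qed

text \<open>Parents are smaller, so the increasing enumeration of a path starts next to the root,
  and its first \<open>lvl v\<close> members form the path to \<open>v\<close>. Projections of
  entries are thus paths again.\<close>

lemma proj_path: "v \<in> path n \<Longrightarrow> proj (lvl v) (path n) = path v"
proof (induction n rule: node_induct)
  case (step n)
  note n = step(1)
  have len: "length (sorted_list_of_set (path m)) = lvl m" for m
    by (simp add: card_path)
  show ?case
  proof (cases "v = n")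
    case True
    then show ?thesis by (simp add: proj_def len[symmetric] finite_path)
  next
    case False
    then have v: "v \<in> path (par n)" using step by (simp add: path_step)
    then have "lvl v \<le> lvl (par n)" by (rule path_lvl_le)
    then have "proj (lvl v) (path n) = proj (lvl v) (path (par n))"
      by (simp add: proj_def sorted_list_path[OF n] card_path)
    then show ?thesis using step(2)[OF v] by simp
  qed
qed simp

lemma proj_0[simp]: "proj 0 w = {}"
  by (simp add: proj_def)

lemma proper_init_seg_path: "proper_init_seg (path a) (path b) \<longleftrightarrow> a \<noteq> b \<and> (a = 0 \<or> a \<in> path b)"
proof
  assume "proper_init_seg (path a) (path b)"
  then have "path a \<subset> path b" by (simp add: proper_init_seg_def)
  then show "a \<noteq> b \<and> (a = 0 \<or> a \<in> path b)" using self_path[of a] by (cases "a = 0") auto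
next
  assume R: "a \<noteq> b \<and> (a = 0 \<or> a \<in> path b)"
  then have eq: "path a = path b \<inter> {..a}" using path_restrict[of a b] path_le[of _ b] by auto
  then have "path a \<subset> path b" using R path_inj[of a b] by auto
  with eq show "proper_init_seg (path a) (path b)" by (auto simp: proper_init_seg_def)
qed

definition leaves :: "nat set \<Rightarrow> nat set" where
  "leaves D = {v \<in> D. \<not> (\<exists>y\<in>D. par y = v)}"

lemma path_subset_closed:
  assumes "\<forall>y\<in>D. par y = 0 \<or> par y \<in> D"
  shows "v \<in> D \<Longrightarrow> path v \<subseteq> D"
proof (induction v rule: node_induct)
  case (step n)
  have "path (par n) \<subseteq> D"
  proof (cases "par n = 0")
    case False
    then show ?thesis using bspec[OF assms step(3)] step(2) by simp
  qed simp
  then show ?case using step(3) unfolding path_step[OF step(1)] by simp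
qed simp

text \<open>Among the members of \<open>D\<close> whose path contains \<open>d\<close>, the largest
  has no child in \<open>D\<close>. So the leaf paths determine \<open>D\<close>.\<close>

lemma Union_leaves:
  assumes "finite D" "0 \<notin> D" "\<forall>y\<in>D. par y = 0 \<or> par y \<in> D"
  shows "(\<Union>v\<in>leaves D. path v) = D"
proof
  show "(\<Union>v\<in>leaves D. path v) \<subseteq> D"
    using path_subset_closed[OF assms(3)] by (auto simp: leaves_def)
  show "D \<subseteq> (\<Union>v\<in>leaves D. path v)"
  proof
    fix d assume d: "d \<in> D"
    let ?A = "{x \<in> D. d \<in> path x}"
    have "0 < d" using d assms(2) by (cases "d = 0") auto
    then have A: "finite ?A" "?A \<noteq> {}" using d assms(1) self_path[of d] by auto
    define x where "x = Max ?A"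
    have x: "x \<in> ?A" unfolding x_def by (rule Max_in[OF A])
    have "x \<in> leaves D"
    proof (rule ccontr)
      assume "x \<notin> leaves D"
      then obtain y where y: "y \<in> D" "par y = x" using x by (auto simp: leaves_def)
      then have "0 < y" using assms(2) by (cases "y = 0") auto
      then have "y \<in> ?A" using x y by (simp add: path_step)
      then have "y \<le> x" unfolding x_def using A(1) by simp
      then show False using par_less[OF \<open>0 < y\<close>] y by simp
    qed
    then show "d \<in> (\<Union>v\<in>leaves D. path v)" using x by auto
  qed
qed

text \<open>Two nodes on one path are comparable, and closure under parents puts the child of the
  smaller one towards the larger one into \<open>D\<close>. Hence an entry can meet at most one
  leaf.\<close>

lemma leaf_unique:
  assumes "\<forall>y\<in>D. par y = 0 \<or> par y \<in> D" "v \<in> leaves D" "w \<in> leaves D" "v \<in> path u" "w \<in> path u"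
  shows "v = w"
proof -
  have *: "\<not> v < w" if "v \<in> leaves D" "w \<in> leaves D" "v \<in> path u" "w \<in> path u" for v w
  proof
    assume "v < w"
    then have "v \<in> path w" using that path_restrict[of w u] by simp
    then obtain y where y: "y \<in> path w" "par y = v" using path_child[of v w] \<open>v < w\<close> by auto
    have "y \<in> D" using y path_subset_closed[OF assms(1), of w] that(2) by (auto simp: leaves_def)
    then show False using that(1) y(2) by (auto simp: leaves_def)
  qed
  show ?thesis using *[of v w] *[of w v] assms by auto
qed

end

section \<open>The tree of non-decreasing sequences\<close>

lemma prec_irrefl: "\<not> js \<prec> js"
  by (auto simp: prec_def lexord_irreflexive)

lemma prec_trans: "js \<prec> ls \<Longrightarrow> ls \<prec> ms \<Longrightarrow> js \<prec> ms"
proof -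
  have "trans {(a :: nat, b). a < b}" by (auto simp: trans_def)
  then show "js \<prec> ls \<Longrightarrow> ls \<prec> ms \<Longrightarrow> js \<prec> ms"
    using lexord_trans[of js ls "{(a, b). a < b}" ms] by (auto simp: prec_def)
qed

lemma prec_linear: "js \<prec> ls \<or> js = ls \<or> ls \<prec> js"
proof -
  have "(js, ls) \<in> lexord {(a :: nat, b). a < b} \<or> js = ls \<or> (ls, js) \<in> lexord {(a, b). a < b}"
    by (rule lexord_linear) auto
  then show ?thesis by (cases "js = []"; cases "ls = []") (auto simp: prec_def)
qed

lemma strict_prefix_prec:
  assumes "sorted ls" "strict_prefix js ls" shows "js \<prec> ls"
proof -
  obtain x z where ls: "ls = js @ x # z" using assms(2) by (auto elim: strict_prefixE')
  have "last js \<le> last ls" if "js \<noteq> []"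
    using assms(1) that last_in_set[of js] last_in_set[of "x # z"] by (auto simp: ls sorted_append simp del: last.simps)
  moreover have "(js, ls) \<in> lexord {(a, b). a < b}"
    unfolding ls by (rule lexord_append_rightI) blast
  ultimately show ?thesis by (auto simp: prec_def ls)
qed

lemma finite_prec:
  assumes "S \<subseteq> seqs_le k" shows "finite {js \<in> S. js \<prec> ls}"
proof (rule finite_subset)
  show "finite {js. set js \<subseteq> {..last ls} \<and> length js \<le> k}" by (rule finite_lists_length_le) simp
  show "{js \<in> S. js \<prec> ls} \<subseteq> {js. set js \<subseteq> {..last ls} \<and> length js \<le> k}"
  proof
    fix js assume js: "js \<in> {js \<in> S. js \<prec> ls}"
    then have s: "sorted js" "length js \<le> k" using assms by (auto simp: seqs_le_def)
    have "x \<le> last ls" if x: "x \<in> set js" for x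
    proof -
      have "js \<noteq> []" using x by auto
      then obtain b y where b: "js = b @ [y]" by (cases js rule: rev_cases) auto
      then have "x \<le> last js" using s(1) x by (auto simp: sorted_append)
      also have "last js \<le> last ls" using js \<open>js \<noteq> []\<close> by (auto simp: prec_def)
      finally show ?thesis .
    qed
    then show "js \<in> {js. set js \<subseteq> {..last ls} \<and> length js \<le> k}" using s(2) by auto
  qed
qed

lemma rank_less:
  assumes S: "S \<subseteq> seqs_le k" and "js \<in> S" "ls \<in> S"
  shows "rank_in S js < rank_in S ls \<longleftrightarrow> js \<prec> ls"
proof -
  have *: "rank_in S js < rank_in S ls" if "js \<prec> ls" "js \<in> S" for js ls
    unfolding rank_in_def
  proof (rule psubset_card_mono[OF finite_prec[OF S]], rule psubsetI)
    show "{xs \<in> S. xs \<prec> js} \<subseteq> {xs \<in> S. xs \<prec> ls}" using that prec_trans by blast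
    show "{xs \<in> S. xs \<prec> js} \<noteq> {xs \<in> S. xs \<prec> ls}" using that prec_irrefl by blast
  qed
  show ?thesis
    using *[of js ls] *[of ls js] prec_linear[of js ls] assms(2,3) by auto
qed

text \<open>By counting, the predecessors of an element exhaust all smaller ranks; an infinite
  initial segment of the naturals is everything.\<close>

lemma rank_bij:
  assumes S: "S \<subseteq> seqs_le k" and inf: "infinite S"
  shows "bij_betw (rank_in S) S UNIV"
proof -
  have inj: "inj_on (rank_in S) S"
    by (rule inj_onI) (metis rank_less[OF S] prec_linear less_irrefl)
  have down: "{..<rank_in S ls} \<subseteq> rank_in S ` S" if "ls \<in> S" for ls
  proof -
    let ?A = "{js \<in> S. js \<prec> ls}"
    have "rank_in S ` ?A = {..<rank_in S ls}"
    proof (rule card_subset_eq)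
      show "rank_in S ` ?A \<subseteq> {..<rank_in S ls}" using rank_less[OF S _ that] by auto
      have "card (rank_in S ` ?A) = card ?A" by (rule card_image) (rule inj_on_subset[OF inj], blast)
      then show "card (rank_in S ` ?A) = card {..<rank_in S ls}" by (simp add: rank_in_def)
    qed simp
    then show ?thesis by blast
  qed
  have "n \<in> rank_in S ` S" for n
  proof -
    have "infinite (rank_in S ` S)" using inf inj finite_imageD by blast
    then have "\<not> rank_in S ` S \<subseteq> {..n}" using finite_subset finite_atMost by blast
    then obtain ls where "ls \<in> S" "n < rank_in S ls"
      unfolding image_subset_iff atMost_iff not_le[symmetric] by blast
    then show ?thesis using down[of ls] by auto
  qed
  with inj show ?thesis by (auto simp: bij_betw_def)
qed

lemma nth_in_spec:
  assumes S: "S \<subseteq> seqs_le k" and inf: "infinite S"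
  shows "nth_in S n \<in> S" "rank_in S (nth_in S n) = n" "js \<in> S \<Longrightarrow> nth_in S (rank_in S js) = js"
proof -
  note bij = rank_bij[OF assms]
  have ex: "\<exists>!js. js \<in> S \<and> rank_in S js = n" for n
  proof -
    have "n \<in> rank_in S ` S" using bij by (simp add: bij_betw_def)
    then obtain js where "js \<in> S" "rank_in S js = n" by auto
    then show ?thesis using inj_onD[OF bij_betw_imp_inj_on[OF bij]] by (intro ex1I[of _ js]) auto
  qed
  from theI'[OF ex[of n]] show "nth_in S n \<in> S" "rank_in S (nth_in S n) = n"
    by (auto simp: nth_in_def)
  show "nth_in S (rank_in S js) = js" if "js \<in> S"
    unfolding nth_in_def by (rule the1_equality[OF ex]) (use that in simp)
qed

locale seq_tree =
  fixes k :: nat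
  assumes k_pos: "0 < k"
begin

abbreviation J :: "nat \<Rightarrow> nat list" where "J \<equiv> jvec k"
abbreviation ix :: "nat list \<Rightarrow> nat" where "ix \<equiv> jidx k"

lemma infinite_seqs_eq: "infinite (seqs_eq k)"
proof -
  have "inj (\<lambda>n :: nat. replicate k n)" using k_pos by (intro injI) simp
  moreover have "range (\<lambda>n. replicate k n) \<subseteq> seqs_eq k"
    by (auto simp: seqs_eq_def sorted_replicate)
  ultimately show ?thesis unfolding infinite_iff_countable_subset by blast
qed

lemma seqs_eq_le: "seqs_eq k \<subseteq> seqs_le k"
  by (auto simp: seqs_eq_def seqs_le_def)

lemma infinite_seqs_le: "infinite (seqs_le k)"
  using infinite_seqs_eq seqs_eq_le finite_subset by blast

lemma J_in: "J m \<in> seqs_le k"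
  and ix_J[simp]: "ix (J m) = m"
  and J_ix: "js \<in> seqs_le k \<Longrightarrow> J (ix js) = js"
  using nth_in_spec[OF order_refl infinite_seqs_le] by (auto simp: jvec_def jidx_def)

lemma ix_less: "js \<in> seqs_le k \<Longrightarrow> ls \<in> seqs_le k \<Longrightarrow> ix js < ix ls \<longleftrightarrow> js \<prec> ls"
  by (simp add: jidx_def rank_less[OF order_refl])

lemma ix_eq: "js \<in> seqs_le k \<Longrightarrow> ls \<in> seqs_le k \<Longrightarrow> ix js = ix ls \<longleftrightarrow> js = ls"
proof -
  assume in_seqs: "js \<in> seqs_le k" "ls \<in> seqs_le k"
  have "js = ls" if "ix js = ix ls"
  proof -
    have "js = J (ix js)" by (rule J_ix[OF in_seqs(1), symmetric])
    also have "\<dots> = J (ix ls)" by (simp only: that)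
    also have "\<dots> = ls" by (rule J_ix[OF in_seqs(2)])
    finally show ?thesis .
  qed
  then show ?thesis by blast
qed

lemma ix_Nil[simp]: "ix [] = 0"
  by (simp add: jidx_def rank_in_def prec_def)

lemma Nil_in: "[] \<in> seqs_le k"
  by (simp add: seqs_le_def)

lemma J_0[simp]: "J 0 = []"
  using J_ix[OF Nil_in] by simp

lemma J_eq_Nil: "J m = [] \<longleftrightarrow> m = 0"
proof
  assume "J m = []"
  then have "ix (J m) = 0" by simp
  then show "m = 0" unfolding ix_J .
qed simp

lemma take_in: "js \<in> seqs_le k \<Longrightarrow> take q js \<in> seqs_le k"
  by (auto simp: seqs_le_def sorted_wrt_take)

lemma butlast_in: "js \<in> seqs_le k \<Longrightarrow> butlast js \<in> seqs_le k"
  by (simp add: butlast_conv_take take_in)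

definition tpar :: "nat \<Rightarrow> nat" where "tpar m = ix (butlast (J m))"
definition tlvl :: "nat \<Rightarrow> nat" where "tlvl m = length (J m)"

lemma J_tpar: "J (tpar m) = butlast (J m)"
  by (simp add: tpar_def J_ix butlast_in J_in)

sublocale node_tree tpar tlvl k
proof
  show "tpar 0 = 0" by (simp add: tpar_def)
  show "tlvl 0 = 0" by (simp add: tlvl_def)
  show "tpar n < n" if "0 < n" for n
  proof -
    have ne: "J n \<noteq> []" using that J_eq_Nil by simp
    then have "strict_prefix (butlast (J n)) (J n)"
      by (intro strict_prefixI'[where z = "last (J n)" and zs = "[]"]) simp
    then have "butlast (J n) \<prec> J n"
      using J_in[of n] by (intro strict_prefix_prec) (auto simp: seqs_le_def)
    then show ?thesis using ix_less[OF butlast_in[OF J_in[of n]] J_in[of n]] by (simp add: tpar_def)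
  qed
  show "tlvl n = Suc (tlvl (tpar n))" if "0 < n" for n
    using that J_eq_Nil[of n] by (simp add: tlvl_def J_tpar)
  show "tlvl n \<le> k" for n using J_in[of n] by (simp add: tlvl_def seqs_le_def)
  show "infinite {n. 0 < n \<and> tpar n = q}" if q: "tlvl q < k" for q
  proof -
    \<comment> \<open>The sum of the entries bounds each of them, also for the empty sequence, so
      these last entries keep the sequence sorted.\<close>
    define f where "f x = ix (J q @ [sum_list (J q) + x])" for x
    have i: "J q @ [sum_list (J q) + x] \<in> seqs_le k" for x
      using q J_in[of q] member_le_sum_list[of _ "J q"]
      by (force simp: tlvl_def seqs_le_def sorted_append intro: trans_le_add1)
    have "inj f"
      by (rule injI) (simp add: f_def ix_eq[OF i i])
    moreover have "range f \<subseteq> {n. 0 < n \<and> tpar n = q}"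
    proof (clarify, intro conjI)
      fix x
      have J: "J (f x) = J q @ [sum_list (J q) + x]" unfolding f_def by (rule J_ix[OF i])
      then show "0 < f x" using J_eq_Nil[of "f x"] by auto
      show "tpar (f x) = q" by (simp add: tpar_def J)
    qed
    ultimately show ?thesis unfolding infinite_iff_countable_subset by blast
  qed
qed

lemma W_J: "W k (J m) = path m"
proof (induction m rule: node_induct)
  case zero
  then show ?case by (auto simp: W_def)
next
  case (step n)
  have ne: "J n \<noteq> []" using step(1) J_eq_Nil by simp
  have "{q. 1 \<le> q \<and> q \<le> length (J n)} = insert (length (J n)) {q. 1 \<le> q \<and> q \<le> length (butlast (J n))}"
    using ne by (cases "J n" rule: rev_cases) auto
  moreover have W: "W k js = (\<lambda>q. ix (take q js)) ` {q. 1 \<le> q \<and> q \<le> length js}" for js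
    by (auto simp: W_def)
  ultimately have "W k (J n) = insert (ix (take (length (J n)) (J n)))
      ((\<lambda>q. ix (take q (J n))) ` {q. 1 \<le> q \<and> q \<le> length (butlast (J n))})"
    by (simp only: image_insert)
  also have "(\<lambda>q. ix (take q (J n))) ` {q. 1 \<le> q \<and> q \<le> length (butlast (J n))} = W k (butlast (J n))"
    unfolding W by (rule image_cong) (auto simp: take_butlast)
  finally show ?case using step by (simp add: path_step J_tpar)
qed

lemma W_ix: "js \<in> seqs_le k \<Longrightarrow> W k js = path (ix js)"
  using W_J[of "ix js"] by (simp add: J_ix)

lemma strict_prefix_J: "strict_prefix (J a) (J b) \<longleftrightarrow> a \<noteq> b \<and> (a = 0 \<or> a \<in> path b)"
proof -
  have "a = 0 \<or> a \<in> path b \<longleftrightarrow> prefix (J a) (J b)"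
  proof (cases "a = 0")
    case False
    then have ne: "J a \<noteq> []" using J_eq_Nil by simp
    have "a \<in> path b \<longleftrightarrow> (\<exists>q. 1 \<le> q \<and> q \<le> length (J b) \<and> a = ix (take q (J b)))"
      unfolding W_J[symmetric] W_def by auto
    also have "\<dots> \<longleftrightarrow> (\<exists>q. 1 \<le> q \<and> q \<le> length (J b) \<and> J a = take q (J b))"
      using J_ix[OF take_in[OF J_in[of b]]] ix_J by metis
    also have "\<dots> \<longleftrightarrow> prefix (J a) (J b)"
    proof
      assume "prefix (J a) (J b)"
      then show "\<exists>q. 1 \<le> q \<and> q \<le> length (J b) \<and> J a = take q (J b)"
        using ne by (intro exI[of _ "length (J a)"]) (cases "J a"; auto simp: prefix_def)
    qed (auto simp: take_is_prefix)
    finally show ?thesis using False by simp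
  qed simp
  moreover have "J a = J b \<longleftrightarrow> a = b" by (metis ix_J)
  ultimately show ?thesis by (auto simp: strict_prefix_def)
qed

end

section \<open>The space of embeddings\<close>

context seq_tree
begin

definition space :: "(nat \<Rightarrow> nat) \<Rightarrow> nat list \<Rightarrow> nat set" where
  "space g = restrict (\<lambda>js. path (g (ix js))) (seqs_eq k)"

lemma E_tree_emb:
  assumes g: "emb g"
  shows "E_tree k (\<lambda>js. path (g (ix js)))"
  unfolding E_tree_def
proof (intro conjI allI impI)
  show "(\<lambda>js. path (g (ix js))) \<in> seqs_le k \<rightarrow> W_hat k"
    using J_in by (auto simp: W_hat_def W_J[symmetric])
  show "card (path (g (ix (J m)))) = length (J m)" for m
    using emb_lvl[OF g, of m] by (simp add: card_path) (simp add: tlvl_def)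
  show "Max (path (g (ix (J m)))) < Max (path (g (ix (J (Suc m)))))" if "1 \<le> m" for m
  proof -
    have "0 < g m" using emb_ge[OF g, of m] that by simp
    moreover have "g m < g (Suc m)" by (simp add: emb_less_iff[OF g])
    ultimately show ?thesis by (simp add: Max_path)
  qed
  show "proper_init_seg (path (g (ix (J m)))) (path (g (ix (J n)))) \<longleftrightarrow> strict_prefix (J m) (J n)" for m n
  proof -
    have "g m = 0 \<longleftrightarrow> m = 0" using emb_eq_iff[OF g, of m 0] g by (simp add: emb_def)
    moreover have "g m \<in> path (g n) \<longleftrightarrow> m \<in> path n"
      by (simp add: path_emb[OF g] inj_image_mem_iff[OF emb_inj[OF g]])
    ultimately show ?thesis
      by (simp add: proper_init_seg_path strict_prefix_J emb_eq_iff[OF g])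
  qed
qed

text \<open>The map \<open>g\<close> reads off the end of each path. Monotonicity comes from the
  condition on maxima; cardinalities and initial segments place the image of a parent on the path
  exactly one level lower, so it is the parent of the image.\<close>

lemma emb_E_tree:
  assumes X: "E_tree k X"
  shows "\<exists>g. emb g \<and> (\<forall>js\<in>seqs_le k. X js = path (g (ix js)))"
proof -
  have "\<exists>n. X (J m) = path n" for m
  proof -
    have "X (J m) \<in> W_hat k" using X J_in[of m] by (auto simp: E_tree_def)
    then show ?thesis using W_ix by (auto simp: W_hat_def)
  qed
  then obtain g where g: "\<And>m. X (J m) = path (g m)" by metis
  have lvl: "tlvl (g m) = tlvl m" for m
  proof -
    have "card (X (J m)) = length (J m)" using X by (simp add: E_tree_def)
    then show ?thesis unfolding g card_path by (simp add: tlvl_def)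
  qed
  have zero: "tlvl m = 0 \<longleftrightarrow> m = 0" for m by (simp add: tlvl_def J_eq_Nil)
  have g0: "g m = 0 \<longleftrightarrow> m = 0" for m using lvl[of m] zero by metis
  have "g m < g (Suc m)" for m
  proof (cases "m = 0")
    case True
    then show ?thesis using g0[of m] g0[of "Suc m"] by simp
  next
    case False
    then have "Max (X (J m)) < Max (X (J (Suc m)))" using X by (simp add: E_tree_def)
    then show ?thesis using g0[of m] g0[of "Suc m"] False by (simp add: g Max_path)
  qed
  then have mono: "strict_mono g" by (simp add: strict_mono_Suc_iff)
  have "tpar (g m) = g (tpar m)" for m
  proof (cases "m = 0")
    case True
    then show ?thesis using g0[of 0] par_0 by simp
  next
    case False
    have "tpar m \<noteq> m \<and> (tpar m = 0 \<or> tpar m \<in> path m)"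
      using False par_less[of m] self_path[of "tpar m"]
      by (cases "tpar m = 0") (auto simp: path_step)
    then have "proper_init_seg (path (g (tpar m))) (path (g m))"
      using X strict_prefix_J[of "tpar m" m] by (simp add: E_tree_def g[symmetric])
    then have *: "g (tpar m) = 0 \<or> g (tpar m) \<in> path (g m)" by (simp add: proper_init_seg_path)
    have gm: "0 < g m" using g0[of m] False by simp
    have l: "Suc (tlvl (g (tpar m))) = tlvl (g m)" using lvl_par[of m] False by (simp add: lvl)
    show ?thesis
    proof (cases "g (tpar m) = 0")
      case True
      then have "tlvl (tpar (g m)) = 0" using l lvl_par[OF gm] lvl_0 by simp
      then show ?thesis using True zero by simp
    next
      case False
      then show ?thesis using * path_lvl_par[OF _ l] by simp
    qed
  qed
  then have "emb g" using mono g0[of 0] by (simp add: emb_def)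
  moreover have "X js = path (g (ix js))" if "js \<in> seqs_le k" for js
    using g[of "ix js"] by (simp add: J_ix[OF that])
  ultimately show ?thesis by blast
qed

lemma space_in: "emb g \<Longrightarrow> space g \<in> E_space k"
  using E_tree_emb unfolding E_space_def space_def by blast

lemma space_ex:
  assumes "X \<in> E_space k" shows "\<exists>g. emb g \<and> X = space g"
proof -
  obtain X' where X': "E_tree k X'" "X = restrict X' (seqs_eq k)" using assms by (auto simp: E_space_def)
  obtain g where g: "emb g" "\<forall>js\<in>seqs_le k. X' js = path (g (ix js))" using emb_E_tree[OF X'(1)] by blast
  have "X = space g" unfolding X'(2) space_def
    by (rule restrict_ext) (use g(2) seqs_eq_le in auto)
  with g(1) show ?thesis by blast
qed

lemma ix_seqs_eq: "ix ` seqs_eq k = {t. tlvl t = k}"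
proof
  show "ix ` seqs_eq k \<subseteq> {t. tlvl t = k}"
    using J_ix seqs_eq_le by (auto simp: tlvl_def seqs_eq_def seqs_le_def)
  show "{t. tlvl t = k} \<subseteq> ix ` seqs_eq k"
  proof
    fix t assume "t \<in> {t. tlvl t = k}"
    then have "J t \<in> seqs_eq k" using J_in[of t] by (simp add: tlvl_def seqs_eq_def seqs_le_def)
    then have "ix (J t) \<in> ix ` seqs_eq k" by (rule imageI)
    then show "t \<in> ix ` seqs_eq k" by simp
  qed
qed

lemma ran_space: "ran_E k (space g) = (\<lambda>t. path (g t)) ` {t. tlvl t = k}"
  unfolding ix_seqs_eq[symmetric] ran_E_def space_def by (simp add: image_image)

lemma le_space: "emb h \<Longrightarrow> le_E k (space (\<lambda>x. g (h x))) (space g)"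
  unfolding le_E_def ran_space by (auto simp: emb_lvl)

section \<open>Top nodes and the part of the tree below them\<close>

definition tp :: "nat \<Rightarrow> nat" where "tp p = ix (ivec k p)"

lemma ivec_in: "ivec k p \<in> seqs_eq k"
  and rank_ivec: "rank_in (seqs_eq k) (ivec k p) = p"
  and ivec_rank: "js \<in> seqs_eq k \<Longrightarrow> ivec k (rank_in (seqs_eq k) js) = js"
  using nth_in_spec[OF seqs_eq_le infinite_seqs_eq] by (auto simp: ivec_def)

lemma tp_less: "tp p < tp q \<longleftrightarrow> p < q"
proof -
  have "tp p < tp q \<longleftrightarrow> ivec k p \<prec> ivec k q"
    unfolding tp_def by (rule ix_less) (use ivec_in seqs_eq_le in auto)
  also have "\<dots> \<longleftrightarrow> p < q"
    using rank_less[OF seqs_eq_le ivec_in ivec_in, of p q] by (simp add: rank_ivec)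
  finally show ?thesis .
qed

lemma lvl_tp: "tlvl (tp p) = k"
  using ix_seqs_eq ivec_in unfolding tp_def by auto

lemma tp_pos: "0 < tp p"
  using lvl_tp[of p] lvl_0 k_pos by (cases "tp p = 0") auto

lemma approximation_space: "approximation k n (space g) = map (\<lambda>p. path (g (tp p))) [0..<n]"
  by (simp add: approximation_def space_def ivec_in tp_def)

text \<open>The first \<open>n\<close> entries of a member of the space involve exactly the nonroot
  nodes up to \<open>tops n\<close>, by \<open>cover\<close>; for \<open>n = 0\<close> only the root
  remains.\<close>

definition tops :: "nat \<Rightarrow> nat" where "tops n = (case n of 0 \<Rightarrow> 0 | Suc p \<Rightarrow> tp p)"

lemma tops_less: "tops m < tops n \<longleftrightarrow> m < n"
  by (cases m; cases n) (auto simp: tops_def tp_less tp_pos)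

lemma tp_le_tops: "p < n \<Longrightarrow> tp p \<le> tops n"
  using tp_less[of p "n - 1"] by (cases n; cases "p = n - 1") (auto simp: tops_def less_Suc_eq)

text \<open>Repeating the last entry of a sequence gives the first sequence of length k that extends it.\<close>
lemma cover:
  assumes "0 < x" "x \<le> tops n"
  shows "\<exists>p<n. x \<in> path (tp p)"
proof -
  obtain m where n: "n = Suc m" using assms by (cases n) (auto simp: tops_def)
  let ?js = "J x"
  let ?pad = "?js @ replicate (k - length ?js) (last ?js)"
  let ?i = "ivec k m"
  have js: "?js \<noteq> []" "sorted ?js" "length ?js \<le> k"
    using assms(1) J_eq_Nil J_in[of x] by (auto simp: seqs_le_def)
  have i: "sorted ?i" "length ?i = k" using ivec_in[of m] by (auto simp: seqs_eq_def)
  have le_last: "y \<le> last zs" if zs: "sorted zs" "y \<in> set zs" for y :: nat and zs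
  proof -
    obtain b z where "zs = b @ [z]" using zs(2) by (cases zs rule: rev_cases) auto
    then show ?thesis using zs by (auto simp: sorted_append)
  qed
  have pad: "?pad \<in> seqs_eq k"
    using js le_last[OF js(2)] by (auto simp: seqs_eq_def sorted_append sorted_replicate)
  have last_pad: "last ?pad = last ?js" by (cases "k - length ?js") auto
  have "x \<le> tp m" using assms(2) by (simp add: n tops_def)
  then have "?js = ?i \<or> ?js \<prec> ?i"
    using ix_less[OF J_in[of x], of ?i] ix_eq[OF J_in[of x], of ?i] ivec_in[of m] seqs_eq_le
    by (auto simp: tp_def le_less)
  then have le: "?pad = ?i \<or> ?pad \<prec> ?i"
  proof
    assume "?js = ?i"
    then show ?thesis using i by simp
  next
    assume "?js \<prec> ?i"
    then have ine: "?i \<noteq> []" and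
      lt: "last ?js < last ?i \<or> last ?js = last ?i \<and> (?js, ?i) \<in> lexord {(a, b). a < b}"
      using js(1) by (auto simp: prec_def)
    from lt show ?thesis
    proof
      assume "last ?js < last ?i"
      then show ?thesis using last_pad ine js(1) by (simp add: prec_def)
    next
      assume l: "last ?js = last ?i \<and> (?js, ?i) \<in> lexord {(a, b). a < b}"
      then consider (pre) y z where "?i = ?js @ y # z"
        | (diff) u a b v w where "a < b" "?js = u @ a # v" "?i = u @ b # w"
        by (auto simp: lexord_def)
      then show ?thesis
      proof cases
        case pre
        \<comment> \<open>Beyond \<open>?js\<close>, the entries of the sorted \<open>?i\<close> lie
          between \<open>last ?js\<close> and \<open>last ?i\<close>, which coincide; so
          \<open>?i\<close> is the padded sequence itself.\<close>
        have "e = last ?js" if e: "e \<in> set (y # z)" for e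
        proof (rule antisym)
          have "e \<in> set ?i" using e unfolding pre set_append by blast
          then show "e \<le> last ?js" using le_last[OF i(1)] conjunct1[OF l] by simp
          show "last ?js \<le> e" using i(1) e js(1) by (auto simp: pre sorted_append)
        qed
        then have "y # z = replicate (length (y # z)) (last ?js)"
          by (intro replicate_eqI) auto
        moreover have len: "length (y # z) = k - length ?js"
          using i(2) arg_cong[OF pre, of length] by simp
        ultimately have "?i = ?pad" unfolding pre len by (simp only:)
        then show ?thesis by simp
      next
        case diff
        have "(?pad, ?i) \<in> lexord {(a, b). a < b}"
          unfolding diff(2,3) append_assoc append_Cons
          by (rule lexord_append_left_rightI) (use diff(1) in simp)
        then show ?thesis using last_pad l ine js(1) by (simp add: prec_def)
      qed
    qed
  qed
  define p where "p = rank_in (seqs_eq k) ?pad"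
  have pp: "ivec k p = ?pad" unfolding p_def by (rule ivec_rank[OF pad])
  have "p \<le> m"
    using le rank_less[OF seqs_eq_le pad ivec_in[of m]] rank_ivec[of m] p_def by auto
  moreover have "x \<in> path (tp p)"
  proof -
    have "take (length ?js) ?pad = ?js" by simp
    then have "x = ix (take (length ?js) ?pad)" by simp
    moreover have "1 \<le> length ?js" "length ?js \<le> length ?pad" using js(1) by (cases "J x"; simp)+
    ultimately have "x \<in> W k ?pad" unfolding W_def by blast
    then show ?thesis using W_ix[of ?pad] pad seqs_eq_le by (auto simp: tp_def pp)
  qed
  ultimately show ?thesis by (intro exI[of _ p]) (simp add: n)
qed

end

section \<open>Projections\<close>

context seq_tree
begin

section \<open>Node lists as codes of approximations\<close>

definition nof :: "nat list \<Rightarrow> nat" where "nof s = (THE n. length s = Suc (tops n))"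

definition ap :: "(nat \<Rightarrow> nat) \<Rightarrow> nat list \<Rightarrow> approx" where
  "ap g s = map (\<lambda>p. path (g (s ! tp p))) [0..<nof s]"

text \<open>Lists ending exactly at the image of a top node, or at the root; any other valid list
  lies strictly between two approximations.\<close>

definition full :: "nat list \<Rightarrow> bool" where
  "full s \<longleftrightarrow> valid s \<and> (\<exists>n. length s = Suc (tops n))"

lemma nof_eq: "length s = Suc (tops n) \<Longrightarrow> nof s = n"
  unfolding nof_def
proof (rule the_equality)
  fix m assume "length s = Suc (tops n)" "length s = Suc (tops m)"
  then show "m = n" using tops_less[of m n] tops_less[of n m] by (cases m n rule: linorder_cases) auto
qed

lemma full_length: "full s \<Longrightarrow> length s = Suc (tops (nof s))"
  using nof_eq by (auto simp: full_def)

lemma full_tp: "full s \<Longrightarrow> p < nof s \<Longrightarrow> tp p < length s"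
  using tp_le_tops[of p "nof s"] full_length by simp

lemma full_map: "emb h \<Longrightarrow> full (map h s) \<longleftrightarrow> full s"
  by (simp add: full_def valid_map)

lemma nof_map[simp]: "nof (map h s) = nof s"
  by (simp add: nof_def)

lemma ap_map: "full s \<Longrightarrow> ap g (map h s) = ap (\<lambda>x. g (h x)) s"
  unfolding ap_def by (auto simp: full_tp)

lemma full_emb:
  assumes "emb g"
  shows "full (map g [0..<Suc (tops n)])" "nof (map g [0..<Suc (tops n)]) = n"
    "ap G (map g [0..<Suc (tops n)]) = map (\<lambda>p. path (G (g (tp p)))) [0..<n]"
proof -
  let ?s = "map g [0..<Suc (tops n)]"
  have l: "length ?s = Suc (tops n)" by simp
  then show n: "nof ?s = n" by (rule nof_eq)
  show "full ?s" unfolding full_def using valid_map_upt[OF assms] l by blast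
  have "?s ! tp p = g (tp p)" if "p < n" for p
    using tp_le_tops[OF that] nth_map[of "tp p" "[0..<Suc (tops n)]" g] by (simp del: upt_Suc)
  then show "ap G ?s = map (\<lambda>p. path (G (g (tp p)))) [0..<n]"
    unfolding ap_def n by simp
qed

definition node_lists :: "(nat \<Rightarrow> nat) \<Rightarrow> approx set \<Rightarrow> nat list set" where
  "node_lists H F = {s. full s \<and> ap H s \<in> F}"

lemma node_front_lists:
  assumes H: "emb H" and F: "front k (space H) F"
  shows "node_front (node_lists H F)"
  unfolding node_front_def
proof (intro conjI ballI allI impI)
  show "valid s" if "s \<in> node_lists H F" for s using that by (simp add: node_lists_def full_def)
next
  fix g assume g: "emb g"
  have "space (\<lambda>x. H (g x)) \<in> E_space k" by (rule space_in[OF emb_comp[OF H g]])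
  then obtain a where a: "a \<in> F" "init_of k a (space (\<lambda>x. H (g x)))"
    using F le_space[OF g, of H] unfolding front_def by blast
  then obtain m where m: "a = map (\<lambda>p. path (H (g (tp p)))) [0..<m]"
    by (auto simp: init_of_def approximation_space)
  then have "map g [0..<Suc (tops m)] \<in> node_lists H F"
    using full_emb[OF g, where n = m] a(1) by (simp add: node_lists_def del: upt_Suc)
  then show "\<exists>n. map g [0..<Suc n] \<in> node_lists H F" by blast
next
  fix s t assume st: "s \<in> node_lists H F" "t \<in> node_lists H F" "prefix s t"
  then have full: "full s" "full t" by (auto simp: node_lists_def)
  obtain z where t: "t = s @ z" using st(3) by (auto simp: prefix_def)
  have "\<not> tops (nof t) < tops (nof s)"
    using full_length[OF full(1)] full_length[OF full(2)] t by simp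
  then have le: "nof s \<le> nof t" by (simp add: tops_less)
  have nth: "t ! tp p = s ! tp p" if "p < nof s" for p
    using full_tp[OF full(1) that] by (simp add: t nth_append)
  have "ap H s = take (nof s) (ap H t)"
    by (rule nth_equalityI) (use le nth in \<open>auto simp: ap_def\<close>)
  then have "init_approx (ap H s) (ap H t)"
    unfolding init_approx_def using le by (intro exI[of _ "nof s"]) (simp add: ap_def)
  then have "ap H s = ap H t"
    using F st(1,2) unfolding front_def node_lists_def by blast
  then have "nof s = nof t" by (metis ap_def length_map length_upt minus_nat.diff_0)
  then have "length s = length t" using full_length full by simp
  then show "s = t" by (simp add: t)
qed

lemma pull_node_lists: "emb G \<Longrightarrow> pull G (node_lists H F) = node_lists (\<lambda>x. H (G x)) F"
proof -
  assume G: "emb G"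
  have "valid s" if "full s" for s using that by (simp add: full_def)
  then show ?thesis
    unfolding pull_def node_lists_def by (auto simp: full_map[OF G] ap_map)
qed

text \<open>The element comes from some embedding \<open>h\<close> of which only the entries are
  known to lie in the subspace. By \<open>cover\<close> every nonroot node up to
  \<open>tops n\<close> is on the path to an entry, so \<open>h\<close> sends it into the required
  range.\<close>

lemma front_restrict_lists:
  assumes F: "F \<subseteq> AR k" and H: "emb H" and g: "emb g"
    and a: "a \<in> front_restrict k F (space (\<lambda>x. H (g x)))"
  shows "\<exists>s\<in>node_lists H F. set s \<subseteq> range g \<and> ap H s = a"
proof -
  let ?G = "\<lambda>x. H (g x)"
  note G = emb_comp[OF H g]
  have aF: "a \<in> F" and sub: "set a \<subseteq> ran_E k (space ?G)" using a by (auto simp: front_restrict_def)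
  obtain n X where X: "X \<in> E_space k" "a = approximation k n X"
    using aF F by (auto simp: AR_def AR_n_def)
  obtain h where h: "emb h" "X = space h" using space_ex[OF X(1)] by blast
  have an: "a = map (\<lambda>p. path (h (tp p))) [0..<n]" using X(2) h(2) by (simp add: approximation_space)
  let ?s = "map h [0..<Suc (tops n)]"
  have ran: "h x \<in> range ?G" if x: "x \<le> tops n" for x
  proof (cases "x = 0")
    case True
    then show ?thesis using h(1) G by (auto simp: emb_def intro: range_eqI[of _ _ 0])
  next
    case False
    then obtain p where p: "p < n" "x \<in> path (tp p)" using cover[of x n] x by auto
    have "path (h (tp p)) \<in> set a" using p(1) by (auto simp: an)
    then obtain t where "path (h (tp p)) = path (?G t)" using sub by (auto simp: ran_space)
    then have "h ` path (tp p) = ?G ` path t" using path_emb[OF h(1)] path_emb[OF G] by simp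
    then show ?thesis using p(2) by blast
  qed
  then have "set ?s \<subseteq> range ?G" by auto
  moreover have "valid ?s" using valid_map_upt[OF h(1)] .
  ultimately obtain t where t: "valid t" "?s = map ?G t" using valid_range_map[OF G] by blast
  let ?t = "map g t"
  have s: "?s = map H ?t" using t(2) by (simp add: comp_def)
  have full: "full ?t" using full_emb(1)[OF h(1), where n = n] unfolding s full_map[OF H] .
  have "ap H ?t = ap (\<lambda>x. x) ?s" unfolding s ap_map[OF full] ..
  also have "\<dots> = a" using full_emb(3)[OF h(1)] an by simp
  finally have "ap H ?t = a" .
  then show ?thesis using full aF by (intro bexI[of _ ?t]) (auto simp: node_lists_def)
qed

definition spare :: "nat list \<Rightarrow> nat set \<Rightarrow> bool" where
  "spare s D \<longleftrightarrow> (\<exists>m<nof s. \<forall>v\<in>leaves D. \<exists>m'<nof s. m' \<noteq> m \<and> v \<in> path (s ! tp m'))"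

lemma in_some_path:
  assumes s: "full s" and v: "v \<in> set s" "v \<noteq> 0"
  shows "\<exists>m<nof s. v \<in> path (s ! tp m)"
proof -
  obtain x where x: "x < length s" "v = s ! x" using v(1) by (metis in_set_conv_nth)
  then have "x \<noteq> 0" using v(2) s by (auto simp: full_def valid_def intro: ccontr)
  then obtain m where m: "m < nof s" "x \<in> path (tp m)"
    using cover[of x "nof s"] x(1) full_length[OF s] by auto
  then have "v \<in> path (s ! tp m)"
    using path_valid[of s "tp m"] s full_tp[OF s m(1)] x(2) by (auto simp: full_def)
  with m(1) show ?thesis by blast
qed

text \<open>Leaves of D are maximal projections, so the entries that must be projected to a leaf path are
  forced; all other entries are projected to the empty set, which is possible iff some entry is spare.\<close>
lemma inner_leaves:
  assumes H: "emb H" and s: "full s" and D: "D \<subseteq> set s - {0}" "\<forall>y\<in>D. tpar y = 0 \<or> tpar y \<in> D"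
  shows "\<exists>ls\<in>proj_vectors k (nof s).
    proj_vec ls (ap H s) = (\<lambda>v. path (H v)) ` leaves D \<union> (if spare s D then {{}} else {})"
proof -
  let ?n = "nof s"
  have ex_m: "\<exists>m<?n. v \<in> path (s ! tp m)" if "v \<in> leaves D" for v
    using in_some_path[OF s, of v] that D(1) by (auto simp: leaves_def)
  \<comment> \<open>\<open>Z\<close> collects the entries projected to the empty set. If no entry is
    spare, each entry alone covers some leaf and \<open>Z\<close> is empty.\<close>
  obtain Z where Z: "Z \<subseteq> {..<?n}" "Z \<noteq> {} \<longleftrightarrow> spare s D"
    and has: "\<And>m. m < ?n \<Longrightarrow> m \<notin> Z \<Longrightarrow> \<exists>v\<in>leaves D. v \<in> path (s ! tp m)"
    and cov: "\<And>v. v \<in> leaves D \<Longrightarrow> \<exists>m<?n. m \<notin> Z \<and> v \<in> path (s ! tp m)"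
  proof (cases "spare s D")
    case True
    then obtain m0 where m0: "m0 < ?n" "\<forall>v\<in>leaves D. \<exists>m'<?n. m' \<noteq> m0 \<and> v \<in> path (s ! tp m')"
      unfolding spare_def by blast
    show ?thesis
    proof (rule that[of "{m. m < ?n \<and> (m = m0 \<or> \<not> (\<exists>v\<in>leaves D. v \<in> path (s ! tp m)))}"])
      show "({m. m < ?n \<and> (m = m0 \<or> \<not> (\<exists>v\<in>leaves D. v \<in> path (s ! tp m)))} \<noteq> {}) = spare s D"
        using True m0(1) by auto
      show "\<exists>m<?n. m \<notin> {m. m < ?n \<and> (m = m0 \<or> \<not> (\<exists>v\<in>leaves D. v \<in> path (s ! tp m)))} \<and>
          v \<in> path (s ! tp m)" if "v \<in> leaves D" for v
        using m0(2) that by auto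
    qed auto
  next
    case False
    show ?thesis
    proof (rule that[of "{}"])
      show "\<exists>v\<in>leaves D. v \<in> path (s ! tp m)" if m: "m < ?n" for m
      proof -
        obtain v where v: "v \<in> leaves D" "\<forall>m'<?n. m' \<noteq> m \<longrightarrow> v \<notin> path (s ! tp m')"
          using False m unfolding spare_def by blast
        then show ?thesis using ex_m[OF v(1)] by blast
      qed
      show "\<exists>m<?n. m \<notin> {} \<and> v \<in> path (s ! tp m)" if "v \<in> leaves D" for v
        using ex_m[OF that] by simp
    qed (use False in auto)
  qed
  define lf where "lf m = (SOME v. v \<in> leaves D \<and> v \<in> path (s ! tp m))" for m
  have lf: "lf m \<in> leaves D \<and> lf m \<in> path (s ! tp m)" if "m < ?n" "m \<notin> Z" for m
    unfolding lf_def by (rule someI_ex) (use has[OF that] in blast)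
  define ls where "ls = map (\<lambda>m. if m \<in> Z then 0 else tlvl (lf m)) [0..<?n]"
  have pr: "proj (tlvl v) (ap H s ! m) = path (H v)" if "m < ?n" "v \<in> path (s ! tp m)" for m v
  proof -
    have "H v \<in> path (H (s ! tp m))" using that(2) by (simp add: path_emb[OF H])
    then show ?thesis using proj_path[of "H v"] that(1) by (simp add: ap_def emb_lvl[OF H])
  qed
  have "ls \<in> proj_vectors k ?n"
    using lvl_le by (auto simp: ls_def proj_vectors_def)
  moreover have "proj_vec ls (ap H s) = (\<lambda>v. path (H v)) ` leaves D \<union> (if spare s D then {{}} else {})"
  proof -
    have "proj_vec ls (ap H s) = (\<lambda>m. proj (ls ! m) (ap H s ! m)) ` {..<?n}"
    proof -
      have "length (ap H s) = ?n" by (simp add: ap_def)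
      then show ?thesis unfolding proj_vec_def lessThan_def by (simp only: setcompr_eq_image)
    qed
    also have "\<dots> = (\<lambda>m. if m \<in> Z then {} else path (H (lf m))) ` {..<?n}"
      by (rule image_cong) (use pr lf in \<open>auto simp: ls_def\<close>)
    also have "\<dots> = (\<lambda>v. path (H v)) ` leaves D \<union> (if spare s D then {{}} else {})" (is "?L = ?R")
    proof
      show "?L \<subseteq> ?R"
      proof
        fix u assume "u \<in> ?L"
        then obtain m where m: "m < ?n" "u = (if m \<in> Z then {} else path (H (lf m)))" by auto
        then show "u \<in> ?R" using lf[of m] Z(2) by (cases "m \<in> Z") auto
      qed
      show "?R \<subseteq> ?L"
      proof
        fix u assume "u \<in> ?R"
        then consider v where "v \<in> leaves D" "u = path (H v)" | "spare s D" "u = {}"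
          by (auto split: if_splits)
        then show "u \<in> ?L"
        proof cases
          case 1
          obtain m where m: "m < ?n" "m \<notin> Z" "v \<in> path (s ! tp m)" using cov[OF 1(1)] by blast
          have "v = lf m" using leaf_unique[OF D(2) 1(1) _ m(3)] lf[OF m(1,2)] by blast
          then show ?thesis using m 1(2) by (intro image_eqI[of _ _ m]) auto
        next
          case 2
          then obtain m where "m \<in> Z" using Z(2) by blast
          then show ?thesis using Z(1) 2 by (intro image_eqI[of _ _ m]) auto
        qed
      qed
    qed
    finally show ?thesis .
  qed
  ultimately show ?thesis by blast
qed

text \<open>Projecting an initial segment gives a subset of the full projection, whichever vector
  represents \<open>\<phi> b\<close>; so it suffices to rule out proper inclusions.\<close>

lemma nash_williamsI:
  assumes "\<And>a b. a \<in> F \<Longrightarrow> b \<in> F \<Longrightarrow> \<phi> a \<subseteq> \<phi> b \<Longrightarrow> \<phi> a = \<phi> b"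
  shows "nash_williams_map k F \<phi>"
  unfolding nash_williams_map_def
proof (intro ballI impI, elim conjE exE)
  fix a b ls n
  assume ab: "a \<in> F" "b \<in> F" and n: "n \<le> length b" and b: "\<phi> b = proj_vec ls b"
    and a: "\<phi> a = proj_vec (take n ls) (take n b)"
  have "proj_vec (take n ls) (take n b) \<subseteq> proj_vec ls b"
    using n by (fastforce simp: proj_vec_def)
  then show "\<phi> a = \<phi> b" using assms[OF ab] a b by simp
qed

theorem canonization:
  assumes A: "A \<in> E_space k" and F: "front k A F" and R: "equiv F R"
  shows "\<exists>B\<in>E_space k. le_E k B A \<and> canonical_on k (front_restrict k F B) R"
proof -
  obtain H0 where H0: "emb H0" "A = space H0" using space_ex[OF A] by blast
  let ?cl = "\<lambda>s. R `` {ap H0 s}"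
  obtain G g D where G: "emb G" and g: "emb g"
    and D: "\<forall>a\<in>pull G (node_lists H0 F). set a \<subseteq> range g \<longrightarrow>
      D a \<subseteq> set a - {0} \<and> (\<forall>y\<in>D a. tpar y = 0 \<or> tpar y \<in> D a)"
    and canon: "\<forall>a\<in>pull G (node_lists H0 F). \<forall>b\<in>pull G (node_lists H0 F).
      set a \<subseteq> range g \<longrightarrow> set b \<subseteq> range g \<longrightarrow>
      (?cl (map G a) = ?cl (map G b) \<longleftrightarrow> D a = D b) \<and> (D a \<subseteq> D b \<longrightarrow> D a = D b)"
    and spare: "(\<forall>a\<in>pull G (node_lists H0 F). set a \<subseteq> range g \<longrightarrow> spare a (D a)) \<or>
      (\<forall>a\<in>pull G (node_lists H0 F). set a \<subseteq> range g \<longrightarrow> \<not> spare a (D a))"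
    using front_canonization[OF node_front_lists[OF H0(1) F[unfolded H0(2)]], of ?cl spare]
    by (elim exE conjE) (rule that)
  define H where "H x = H0 (G x)" for x
  have H: "emb H" unfolding H_def by (rule emb_comp[OF H0(1) G])
  define L where "L = node_lists H F"
  have pull: "pull G (node_lists H0 F) = L"
    unfolding L_def H_def by (rule pull_node_lists[OF G])
  define good where "good s \<longleftrightarrow> s \<in> L \<and> set s \<subseteq> range g" for s
  have cl: "?cl (map G s) = R `` {ap H s}" if "s \<in> L" for s
    using that ap_map[of s H0 G] unfolding L_def node_lists_def H_def by simp
  have D1: "D s \<subseteq> set s - {0}" and D2: "\<forall>y\<in>D s. tpar y = 0 \<or> tpar y \<in> D s" if "good s" for s
    using D that unfolding pull good_def by auto
  have cl_D: "R `` {ap H s} = R `` {ap H t} \<longleftrightarrow> D s = D t"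
    and min_D: "D s \<subseteq> D t \<Longrightarrow> D s = D t" if "good s" "good t" for s t
    using canon that cl unfolding pull good_def by auto
  \<comment> \<open>Homogeneity fixes whether the empty set belongs to the values, so that
    \<open>\<phi> a\<close> depends on the recorded nodes only.\<close>
  obtain sp where sp: "\<And>s. good s \<Longrightarrow> spare s (D s) \<longleftrightarrow> sp"
    using spare unfolding pull good_def by metis
  define B where "B = space (\<lambda>x. H (g x))"
  define \<psi> where "\<psi> a = (SOME s. good s \<and> ap H s = a)" for a
  have \<psi>: "good (\<psi> a) \<and> ap H (\<psi> a) = a" if "a \<in> front_restrict k F B" for a
    unfolding \<psi>_def
    by (rule someI_ex)
      (use front_restrict_lists[OF _ H g that[unfolded B_def]] F in
        \<open>auto simp: good_def L_def front_def\<close>)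
  define \<phi> where "\<phi> a = (\<lambda>v. path (H v)) ` leaves (D (\<psi> a)) \<union> (if sp then {{}} else {})" for a
  \<comment> \<open>The empty set adds nothing to the union, so the value determines the recorded
    nodes, and inclusions between values pass to them.\<close>
  have Un_\<phi>: "\<Union> (\<phi> a) = H ` D (\<psi> a)" if "a \<in> front_restrict k F B" for a
  proof -
    have gd: "good (\<psi> a)" using \<psi>[OF that] by blast
    have "\<Union> (\<phi> a) = H ` (\<Union>v\<in>leaves (D (\<psi> a)). path v)"
      by (auto simp: \<phi>_def path_emb[OF H])
    also have "(\<Union>v\<in>leaves (D (\<psi> a)). path v) = D (\<psi> a)"
    proof (rule Union_leaves[OF _ _ D2[OF gd]])
      show "finite (D (\<psi> a))" by (rule finite_subset[OF D1[OF gd]]) simp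
      show "0 \<notin> D (\<psi> a)" using D1[OF gd] by auto
    qed
    finally show ?thesis .
  qed
  have sub_D: "D (\<psi> a) \<subseteq> D (\<psi> b)"
    if "a \<in> front_restrict k F B" "b \<in> front_restrict k F B" "\<phi> a \<subseteq> \<phi> b" for a b
    using Union_mono[OF that(3)] Un_\<phi>[OF that(1)] Un_\<phi>[OF that(2)]
    by (simp add: inj_image_subset_iff[OF emb_inj[OF H]])
  have "inner_map k (front_restrict k F B) \<phi>"
    unfolding inner_map_def
  proof
    fix a assume a: "a \<in> front_restrict k F B"
    let ?s = "\<psi> a"
    have gd: "good ?s" and apa: "ap H ?s = a" using \<psi>[OF a] by auto
    have full: "full ?s" using gd by (simp add: good_def L_def node_lists_def)
    have "nof ?s = length a" using arg_cong[OF apa, of length] by (simp add: ap_def)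
    moreover obtain ls where "ls \<in> proj_vectors k (nof ?s)" "proj_vec ls (ap H ?s) =
        (\<lambda>v. path (H v)) ` leaves (D ?s) \<union> (if spare ?s (D ?s) then {{}} else {})"
      using inner_leaves[OF H full D1[OF gd] D2[OF gd]] by (elim bexE)
    ultimately show "\<exists>ls\<in>proj_vectors k (length a). \<phi> a = proj_vec ls a"
      by (intro bexI[of _ ls]) (simp_all add: \<phi>_def apa sp[OF gd])
  qed
  moreover have "nash_williams_map k (front_restrict k F B) \<phi>"
  proof (rule nash_williamsI)
    fix a b assume ab: "a \<in> front_restrict k F B" "b \<in> front_restrict k F B" "\<phi> a \<subseteq> \<phi> b"
    have "D (\<psi> a) = D (\<psi> b)"
      using sub_D[OF ab] \<psi>[OF ab(1)] \<psi>[OF ab(2)] min_D[of "\<psi> a" "\<psi> b"] by simp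
    then show "\<phi> a = \<phi> b" by (simp add: \<phi>_def)
  qed
  moreover have "(a, b) \<in> R \<longleftrightarrow> \<phi> a = \<phi> b"
    if a: "a \<in> front_restrict k F B" and b: "b \<in> front_restrict k F B" for a b
  proof -
    have "a \<in> F" "b \<in> F" using a b by (auto simp: front_restrict_def)
    then have "(a, b) \<in> R \<longleftrightarrow> R `` {a} = R `` {b}" using eq_equiv_class_iff[OF R] by simp
    also have "\<dots> \<longleftrightarrow> D (\<psi> a) = D (\<psi> b)"
      using cl_D[of "\<psi> a" "\<psi> b"] \<psi>[OF a] \<psi>[OF b] by simp
    also have "\<dots> \<longleftrightarrow> \<phi> a = \<phi> b"
    proof
      assume "\<phi> a = \<phi> b"
      then show "D (\<psi> a) = D (\<psi> b)" using sub_D[OF a b] sub_D[OF b a] by auto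
    qed (simp add: \<phi>_def)
    finally show ?thesis .
  qed
  ultimately have "canonical_on k (front_restrict k F B) R"
    unfolding canonical_on_def irreducible_map_def by blast
  moreover have "B \<in> E_space k" unfolding B_def by (rule space_in[OF emb_comp[OF H g]])
  moreover have "le_E k B A"
    unfolding B_def H0(2) H_def by (rule le_space[OF emb_comp[OF G g]])
  ultimately show ?thesis by blast
qed

end

theorem theorem33:
  fixes k :: nat
    and A :: "nat list \<Rightarrow> nat set"
    and F :: "approx set"
    and R :: "(approx \<times> approx) set"
  assumes "2 \<le> k"
    and "A \<in> E_space k"
    and "front k A F"
    and "equiv F R"
  shows "\<exists>B\<in>E_space k. le_E k B A \<and> canonical_on k (front_restrict k F B) R"
proof -
  interpret seq_tree k by unfold_locales (use assms(1) in simp)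
  show ?thesis using assms(2-4) by (rule canonization)
qed

end
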